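(* For all integers $k\ge 2$, \[ GR_k(W_4)= \begin{cases} 14\cdot 5^{\frac{k-2}{2}}+1, & \text{if } k \text{ is even},\\ 28\cdot 5^{\frac{k-3}{2}}+1, & \text{if } k \text{ is odd}. \end{cases} \]
   Context: A Gallai coloring of a complete graph is an edge-coloring with no rainbow triangle (a triangle whose three edges receive three distinct colors). A Gallai $k$-coloring is a Gallai coloring using at most $k$ colors. For a graph $H$ and integer $k\ge1$, the Gallai-Ramsey number $GR_k(H)$ is the least positive integer $N$ such that every Gallai $k$-coloring of the edges of the complete graph $K_N$ contains a monochromatic copy of $H$. $W_n$ denotes the wheel on $n+1$ vertices, i.e. a cycle $C_n$ together with one extra vertex adjacent to all vertices of the cycle; thus $W_4$ has 5 vertices. *)

theory Defs
  imports Main "HOL-Library.Ramsey" "HOL-Library.Extended_Nat"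
begin

text \<open>Simple graphs are pairs of a vertex set and a set of two-element vertex sets. The complete
  graph on a vertex set \<open>V\<close> has edge set \<^term>\<open>nsets V 2\<close>, and an edge coloring assigns a color to
  each such two-element set (its values on other sets are irrelevant).\<close>

type_synonym 'a ugraph = "'a set \<times> 'a set set"

abbreviation verts :: "'a ugraph \<Rightarrow> 'a set" where "verts H \<equiv> fst H"
abbreviation edges :: "'a ugraph \<Rightarrow> 'a set set" where "edges H \<equiv> snd H"

definition complete_graph :: "nat \<Rightarrow> nat ugraph" where
  "complete_graph N = ({..<N}, nsets {..<N} 2)"

definition cycle_graph :: "nat \<Rightarrow> nat ugraph" where
  "cycle_graph n = ({..<n}, {{i, Suc i mod n} | i. i < n})"

text \<open>The hub is the vertex \<open>n\<close>; meaningful for \<open>n \<ge> 3\<close>.\<close>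

definition wheel_graph :: "nat \<Rightarrow> nat ugraph" where
  "wheel_graph n =
     (insert n (verts (cycle_graph n)),
      edges (cycle_graph n) \<union> {{i, n} | i. i \<in> verts (cycle_graph n)})"

definition rainbow_triangle :: "'a ugraph \<Rightarrow> ('a set \<Rightarrow> 'c) \<Rightarrow> 'a \<Rightarrow> 'a \<Rightarrow> 'a \<Rightarrow> bool" where
  "rainbow_triangle G c x y z \<longleftrightarrow>
     {x, y} \<in> edges G \<and> {y, z} \<in> edges G \<and> {x, z} \<in> edges G \<and>
     c {x, y} \<noteq> c {y, z} \<and> c {y, z} \<noteq> c {x, z} \<and> c {x, y} \<noteq> c {x, z}"

definition gallai_coloring :: "'a ugraph \<Rightarrow> ('a set \<Rightarrow> 'c) \<Rightarrow> bool" where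
  "gallai_coloring G c \<longleftrightarrow> (\<nexists>x y z. rainbow_triangle G c x y z)"

definition gallai_k_coloring :: "nat \<Rightarrow> 'a ugraph \<Rightarrow> ('a set \<Rightarrow> 'c) \<Rightarrow> bool" where
  "gallai_k_coloring k G c \<longleftrightarrow> gallai_coloring G c \<and> card (c ` edges G) \<le> k"

text \<open>A copy is a not necessarily induced subgraph isomorphic to \<open>H\<close>.\<close>

definition has_mono_copy :: "'b ugraph \<Rightarrow> 'a ugraph \<Rightarrow> ('a set \<Rightarrow> 'c) \<Rightarrow> bool" where
  "has_mono_copy H G c \<longleftrightarrow>
     (\<exists>f col. inj_on f (verts H) \<and> f ` verts H \<subseteq> verts G \<and>
        (\<forall>e\<in>edges H. f ` e \<in> edges G \<and> c (f ` e) = col))"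

text \<open>The least such \<open>N\<close> is taken in \<^typ>\<open>enat\<close>: the value is \<open>\<infinity>\<close> if there is no such \<open>N\<close>, so an
  equation with a finite value also asserts existence. Colors are natural numbers, which is
  no restriction since only finitely many occur.\<close>

definition gallai_ramsey :: "nat \<Rightarrow> 'b ugraph \<Rightarrow> enat" where
  "gallai_ramsey k H =
     (INF N \<in> {N. N > 0 \<and>
        (\<forall>c :: nat set \<Rightarrow> nat. gallai_k_coloring k (complete_graph N) c
           \<longrightarrow> has_mono_copy H (complete_graph N) c)}. enat N)"

end

theory Submission
  imports Defs
begin

text \<open>Five vertices contain a wheel \<open>W\<^sub>4\<close> of color \<open>i\<close> as soon as the pairs of other colors among
  them form a matching, since \<open>W\<^sub>4\<close> is the complement of two disjoint edges in \<open>K\<^sub>5\<close>.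

  Two colors: among 15 vertices some vertex \<open>v\<close> has 8 neighbors in one color, say red. The red
  graph on these has no 4-cycle and its complement has no wheel, and up to isomorphism there is
  only one such graph. Each of the other 6 vertices can be joined to these 9 in only 6 ways, no
  two vertices can use the same way, and two of the ways exclude each other.

  For \<open>k \<ge> 3\<close> colors let \<open>f\<close> denote the bound. A color that forms a matching on a vertex set can
  be merged into any other color without creating a wheel, so that such a set has at most
  \<open>f (k - 1)\<close> vertices, and at most \<open>f (k - 2)\<close> if there are two such colors.
  If there is a monochromatic cut with at least two vertices on both sides, its color forms a
  matching on both sides, which gives \<open>2 f (k - 1) \<le> f k\<close>. Vertices that are monochromatic to
  the rest are peeled off beforehand. If no monochromatic cut remains, take a Gallai partition,
  with colors red and blue between the classes. If all classes are singletons, the two-color case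
  applies. Otherwise, let \<open>P\<close> be a class with at least two vertices: generically red and blue
  both form matchings on \<open>P\<close>, and the red and the blue neighborhood of \<open>P\<close> have at most
  \<open>2 f (k - 2)\<close> vertices each, in total \<open>5 f (k - 2) \<le> f k\<close>.

  For the lower bound, a circulant coloring on 14 vertices is substituted repeatedly into the
  2-coloring of \<open>K\<^sub>5\<close> without monochromatic triangle and, for odd \<open>k\<close>, into a single edge.\<close>

section \<open>Wheels and 4-cycles in a symmetric relation\<close>

definition wheel :: "('a \<Rightarrow> 'a \<Rightarrow> bool) \<Rightarrow> 'a set \<Rightarrow> bool" where
  "wheel R V \<longleftrightarrow> (\<exists>h a b c d. {h, a, b, c, d} \<subseteq> V \<and> distinct [h, a, b, c, d] \<and>
     R h a \<and> R h b \<and> R h c \<and> R h d \<and> R a b \<and> R b c \<and> R c d \<and> R d a)"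

lemma wheelI:
  assumes "symp R" "irreflp R" "{h, a, b, c, d} \<subseteq> V" "h \<noteq> a" "a \<noteq> c" "b \<noteq> d"
    and "R h a" "R h b" "R h c" "R h d" "R a b" "R b c" "R c d" "R d a"
  shows "wheel R V"
proof -
  have "distinct [h, a, b, c, d]"
    using assms by (auto dest: irreflpD)
  then show ?thesis
    unfolding wheel_def using assms by blast
qed

lemma wheel_mono: "wheel R V \<Longrightarrow> V \<subseteq> W \<Longrightarrow> wheel R W"
  unfolding wheel_def by (meson subset_trans)

definition four_cycle :: "('a \<Rightarrow> 'a \<Rightarrow> bool) \<Rightarrow> 'a set \<Rightarrow> bool" where
  "four_cycle R V \<longleftrightarrow> (\<exists>a b c d. {a, b, c, d} \<subseteq> V \<and> distinct [a, b, c, d] \<and>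
     R a b \<and> R b c \<and> R c d \<and> R d a)"

lemma four_cycle_mono: "four_cycle R V \<Longrightarrow> V \<subseteq> W \<Longrightarrow> four_cycle R W"
  unfolding four_cycle_def by (meson subset_trans)

section \<open>Enumeration of small graphs by adjacency matrices\<close>

definition adjacency :: "('a \<Rightarrow> 'a \<Rightarrow> bool) \<Rightarrow> 'a list \<Rightarrow> bool list list" where
  "adjacency R vs = map (\<lambda>x. map (R x) vs) vs"

primrec twice :: "bool list \<Rightarrow> bool" where
  "twice [] \<longleftrightarrow> False"
| "twice (b # bs) \<longleftrightarrow> (if b then list_ex id bs else twice bs)"

definition meet :: "bool list \<Rightarrow> bool list \<Rightarrow> bool list" where
  "meet xs ys = map2 (\<and>) xs ys"

text \<open>Tests for a 4-cycle through a new vertex with row \<open>r\<close>: the vertex opposite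
  to it is an old one that shares two neighbors with it.\<close>

definition four_cycle_at :: "bool list list \<Rightarrow> bool list \<Rightarrow> bool" where
  "four_cycle_at M r \<longleftrightarrow> list_ex (\<lambda>s. twice (meet s r)) M"

text \<open>Tests for a wheel through a new vertex with row \<open>r\<close>. Two common neighbors
  of the new vertex, \<open>i\<close> and \<open>j\<close> are opposite on the rim; either the new
  vertex is the hub and \<open>i\<close>, \<open>j\<close> are opposite, or \<open>i\<close> is the
  hub and the new vertex is opposite to \<open>j\<close>.\<close>

definition wheel_at :: "bool list list \<Rightarrow> bool list \<Rightarrow> bool" where
  "wheel_at M r \<longleftrightarrow> list_ex (\<lambda>i. r ! i \<and> list_ex (\<lambda>j. i \<noteq> j \<and> (r ! j \<or> M ! i ! j) \<and>
     twice (meet (M ! i) (meet (M ! j) r))) [0..<length r]) [0..<length r]"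

definition complement :: "bool list list \<Rightarrow> bool list list" where
  "complement M = map (\<lambda>i. map (\<lambda>j. i \<noteq> j \<and> \<not> M ! i ! j) [0..<length M]) [0..<length M]"

definition extend :: "bool list list \<Rightarrow> bool list \<Rightarrow> bool list list" where
  "extend M r = map2 (\<lambda>s b. s @ [b]) M r @ [r @ [False]]"

primrec rows :: "nat \<Rightarrow> bool list list" where
  "rows 0 = [[]]"
| "rows (Suc n) = map (Cons True) (rows n) @ map (Cons False) (rows n)"

text \<open>\<open>M'\<close> stands for the complement of \<open>M\<close>; as an argument it need
  not be recomputed for every row.\<close>

definition good_rows :: "bool list list \<Rightarrow> bool list list \<Rightarrow> bool list list" where
  "good_rows M M' = filter (\<lambda>r. \<not> four_cycle_at M r \<and> \<not> wheel_at M' (map Not r)) (rows (length M))"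

definition extensions :: "bool list list \<Rightarrow> bool list list list" where
  "extensions M = map (extend M) (good_rows M (complement M))"

definition permute :: "nat list \<Rightarrow> bool list list \<Rightarrow> bool list list" where
  "permute p M = map (\<lambda>i. map (\<lambda>j. M ! i ! j) p) p"

definition permutes_length :: "nat list \<Rightarrow> nat \<Rightarrow> bool" where
  "permutes_length p n \<longleftrightarrow> length p = n \<and> distinct p \<and> list_all (\<lambda>i. i < n) p"

text \<open>The second argument supplies hints: a permutation carrying the next matrix to a matrix that
  is already listed, or \<open>[]\<close>. A wrong hint only leads to a redundant entry.\<close>

fun prune :: "bool list list list \<Rightarrow> nat list list \<Rightarrow> bool list list list \<Rightarrow> bool list list list" where
  "prune [] ps acc = acc"
| "prune (E # Es) [] acc = prune Es [] (E # acc)"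
| "prune (E # Es) (p # ps) acc =
    (if permutes_length p (length E) \<and> permute p E \<in> set acc then prune Es ps acc
     else prune Es ps (E # acc))"

fun classes :: "nat list list list \<Rightarrow> bool list list list \<Rightarrow> bool list list list" where
  "classes [] L = L"
| "classes (ps # pss) L = classes pss (prune (concat (map extensions L)) ps [])"

text \<open>Up to isomorphism the only graph on 8 vertices that has no 4-cycle and whose complement has
  no wheel; adding a vertex adjacent to all of them gives \<open>nine\<close> below.\<close>

definition eight :: "bool list list" where
  "eight =
   [[False, False, True, True, False, True, False, False],
    [False, False, False, True, True, False, False, True],
    [True, False, False, False, True, True, False, False],
    [True, True, False, False, False, False, False, True],
    [False, True, True, False, False, False, False, False],
    [True, False, True, False, False, False, True, False],
    [False, False, False, False, False, True, False, True],
    [False, True, False, True, False, False, True, False]]"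

text \<open>One list for each of the seven steps from 1 to 8 vertices, with the hints in the order
  in which the extensions are produced.\<close>

definition hints :: "nat list list list" where
  "hints =
   [[],
    [[],[],[1,0,2],[],[],[1,2,0],[0,2,1],[0,2,1]],
    [[],[1,0,2,3],[2,0,1,3],[],[],[],[0,2,1,3],[],[1,2,0,3],[1,0,2,3],[2,0,1,3],[],[3,0,2,1],[],
     [0,2,3,1],[2,3,1,0],[2,1,0,3],[],[0,3,1,2],[0,1,3,2],[2,0,3,1],[0,1,3,2],[2,1,3,0],[1,0,3,2],
     [0,1,3,2],[0,1,3,2]],
    [[],[],[1,0,3,2,4],[],[0,3,2,1,4],[],[0,3,2,1,4],[],[1,2,3,0,4],[1,2,3,0,4],[1,0,3,2,4],
     [1,0,3,2,4],[2,3,0,1,4],[2,1,0,3,4],[3,0,1,2,4],[2,3,4,1,0],[],[],[],[1,0,4,2,3],[0,1,2,4,3],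
     [2,3,4,1,0],[3,2,1,0,4],[],[],[],[0,1,3,2,4],[],[0,2,3,1,4],[0,2,1,3,4],[0,3,1,2,4],[1,2,3,0,4],
     [1,2,0,3,4],[1,3,0,2,4],[2,3,0,1,4],[],[4,3,1,0,2],[],[0,1,3,4,2],[0,2,1,3,4],[0,2,3,4,1],[],
     [3,4,1,2,0],[4,0,1,3,2],[4,0,1,3,2],[3,1,0,4,2],[3,2,0,4,1],[0,4,1,2,3],[3,2,1,4,0],[3,4,1,2,0],
     [0,1,2,4,3],[0,1,4,3,2],[3,2,0,4,1],[3,4,0,2,1],[1,0,2,4,3],[1,0,4,3,2],[3,2,0,4,1],[3,2,0,4,1],
     [0,1,4,2,3],[0,1,2,4,3],[0,1,2,4,3],[3,4,1,0,2],[1,0,2,4,3],[3,4,0,1,2],[2,0,1,4,3],[3,4,0,2,1],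
     [0,1,2,4,3],[0,1,2,4,3],[1,4,2,3,0],[1,4,3,2,0],[0,4,2,3,1],[0,4,3,2,1],[0,4,1,3,2],[0,4,3,1,2],
     [0,3,1,4,2],[0,3,4,1,2],[1,3,2,4,0],[1,3,4,2,0],[0,4,3,1,2],[0,4,3,2,1],[1,3,2,4,0],[1,3,4,2,0]],
    [[],[3,1,2,0,4,5],[4,1,2,0,3,5],[],[],[],[],[],[3,1,2,0,4,5],[3,1,2,0,4,5],[],[3,1,2,0,4,5],
     [4,2,3,0,5,1],[],[4,2,3,0,5,1],[4,3,2,0,5,1],[4,2,3,1,5,0],[1,0,2,3,4,5],[4,2,3,1,5,0],
     [4,3,2,1,5,0],[],[],[5,1,2,0,4,3],[0,3,1,2,5,4],[5,0,2,1,4,3],[1,3,0,2,5,4],[5,0,1,2,4,3],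
     [2,3,0,1,5,4],[0,4,1,2,5,3],[],[0,1,4,5,3,2],[],[],[3,4,2,1,5,0],[],[3,2,1,0,4,5],[],
     [0,4,3,2,1,5],[1,2,3,4,5,0],[1,2,3,4,0,5],[1,0,4,3,2,5],[0,4,3,2,5,1],[2,3,4,0,1,5],
     [1,0,4,3,5,2],[2,1,0,4,5,3],[0,1,2,3,5,4],[0,1,2,3,5,4],[3,2,4,5,0,1],[1,2,3,5,4,0],
     [3,2,4,1,5,0],[1,4,3,5,2,0],[3,5,2,4,1,0],[1,5,2,4,3,0],[2,4,1,5,0,3],[3,2,5,4,0,1],
     [0,5,3,2,1,4],[1,4,2,5,3,0],[3,2,5,4,0,1],[0,1,5,4,3,2],[0,1,5,4,3,2],[0,1,2,3,5,4],
     [0,1,5,4,3,2],[1,2,4,3,5,0],[5,4,3,2,0,1],[1,4,2,3,5,0],[5,2,4,1,3,0],[5,2,3,4,0,1],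
     [5,3,2,4,1,0],[5,4,1,2,0,3],[5,2,1,4,0,3],[5,1,2,4,3,0],[1,2,4,3,5,0],[0,5,4,2,3,1],
     [1,4,2,3,5,0],[1,2,4,3,5,0],[0,5,2,4,3,1],[2,4,3,5,0,1],[0,5,4,2,1,3],[0,5,2,4,1,3],
     [1,5,2,4,3,0],[],[2,5,3,4,0,1],[2,5,1,4,0,3],[2,1,0,3,4,5],[0,5,3,4,2,1],[4,1,0,3,2,5],[],
     [0,5,3,2,4,1],[0,3,5,2,4,1],[0,5,1,4,2,3],[0,5,1,2,4,3],[0,1,5,2,4,3],[0,1,5,4,3,2],
     [2,4,3,5,0,1],[1,5,4,3,2,0],[4,2,3,5,0,1],[4,3,2,5,1,0],[1,0,5,4,2,3],[0,5,4,2,3,1],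
     [3,4,2,5,1,0],[4,3,2,5,1,0],[4,2,3,5,0,1],[],[1,0,3,4,5,2],[0,1,2,4,5,3],[0,3,4,5,1,2],
     [4,5,3,2,0,1],[1,0,3,2,5,4],[0,5,3,2,4,1],[4,3,5,0,2,1],[2,3,4,5,1,0],[4,5,3,0,2,1],
     [0,1,5,2,4,3],[1,2,5,3,4,0],[0,3,5,2,4,1],[1,0,5,3,4,2],[0,1,5,2,4,3]],
    [[],[0,5,4,3,2,1,6],[1,0,3,2,4,5,6],[1,5,4,2,3,0,6],[2,4,5,1,0,3,6],[3,4,5,0,1,2,6],[],
     [0,1,4,3,2,5,6],[0,3,2,1,4,5,6],[0,3,4,1,2,5,6],[],[0,1,2,6,5,3,4],[2,1,0,6,5,4,3],[],[],
     [2,1,0,4,3,5,6],[],[6,1,0,5,3,2,4],[0,1,6,5,3,4,2],[3,5,6,1,4,0,2],[1,0,6,3,2,5,4],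
     [5,3,6,0,1,2,4],[],[0,1,2,3,5,6,4],[0,5,3,2,1,6,4],[1,2,3,5,0,6,4],[1,0,5,3,2,6,4],
     [2,3,5,0,1,6,4],[0,5,3,2,1,6,4],[0,5,3,2,1,6,4],[0,6,3,2,1,5,4],[0,6,3,2,1,5,4],[3,6,5,1,4,0,2],
     [0,6,5,2,4,3,1],[],[0,1,3,2,4,5,6],[1,0,2,3,4,5,6],[1,0,3,2,4,5,6],[4,5,6,0,2,1,3],
     [4,5,6,0,3,1,2],[0,5,4,2,3,6,1],[0,2,4,5,6,1,3],[0,5,4,6,1,3,2],[3,5,4,2,0,6,1],[3,2,4,5,6,1,0],
     [3,5,4,6,1,0,2],[4,2,0,5,6,3,1],[1,2,3,6,5,0,4],[4,2,3,5,6,0,1],[0,6,1,2,3,5,4],[3,1,5,2,4,6,0],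
     [1,2,3,5,6,0,4],[0,6,4,5,1,3,2],[3,1,6,2,4,5,0],[4,2,0,6,5,3,1],[0,6,4,2,3,5,1],[0,2,4,6,5,1,3],
     [0,2,3,5,6,4,1]],
    [[],[2,1,0,4,3,5,6,7],[0,1,2,5,6,4,7,3],[6,1,0,7,4,2,5,3]]]"

lemma classes_eight: "length hints = 7" "classes hints [[[False]]] = [eight]"
  by code_simp+

section \<open>From matrix computations to statements about graphs\<close>

abbreviation co :: "('a \<Rightarrow> 'a \<Rightarrow> bool) \<Rightarrow> 'a \<Rightarrow> 'a \<Rightarrow> bool" where
  "co R \<equiv> \<lambda>x y. x \<noteq> y \<and> \<not> R x y"

lemma symp_co: "symp R \<Longrightarrow> symp (co R)"
  by (auto simp: symp_def)

lemma irreflp_co: "irreflp (co R)"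
  by (auto simp: irreflp_def)

lemma adjacency_snoc:
  assumes "symp R" "irreflp R"
  shows "adjacency R (vs @ [u]) = extend (adjacency R vs) (map (R u) vs)"
  using assms by (auto simp: adjacency_def extend_def map2_map_map dest: sympD irreflpD)

lemma length_adjacency [simp]: "length (adjacency R vs) = length vs"
  by (simp add: adjacency_def)

lemma adjacency_nth: "i < length vs \<Longrightarrow> adjacency R vs ! i = map (R (vs ! i)) vs"
  by (simp add: adjacency_def)

lemma complement_adjacency: "distinct vs \<Longrightarrow> complement (adjacency R vs) = adjacency (co R) vs"
  by (intro nth_equalityI) (auto simp: complement_def adjacency_nth nth_eq_iff_index_eq)

lemma twice_map:
  assumes "twice (map P vs)" "distinct vs"
  obtains x y where "x \<noteq> y" "x \<in> set vs" "y \<in> set vs" "P x" "P y"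
proof -
  have "\<exists>x y. x \<noteq> y \<and> x \<in> set vs \<and> y \<in> set vs \<and> P x \<and> P y"
    using assms
  proof (induction vs)
    case (Cons a vs)
    show ?case
    proof (cases "P a")
      case True
      then obtain x where "x \<in> set vs" "P x"
        using Cons.prems(1) by (auto simp: list_ex_iff)
      then show ?thesis
        using True Cons.prems(2) by (intro exI[of _ a] exI[of _ x]) auto
    next
      case False
      then show ?thesis
        using Cons by auto
    qed
  qed simp
  then show ?thesis
    using that by blast
qed

lemma meet_map: "meet (map P vs) (map Q vs) = map (\<lambda>x. P x \<and> Q x) vs"
  by (simp add: meet_def map2_map_map)

lemma four_cycle_atD:
  assumes "symp R" "irreflp R" "distinct vs" "u \<notin> set vs"
    and "four_cycle_at (adjacency R vs) (map (R u) vs)"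
  shows "four_cycle R (insert u (set vs))"
proof -
  obtain z where z: "z \<in> set vs" "twice (map (\<lambda>x. R z x \<and> R u x) vs)"
    using assms(5) by (auto simp: four_cycle_at_def adjacency_def list_ex_iff meet_map)
  obtain x y where xy: "x \<noteq> y" "x \<in> set vs" "y \<in> set vs" "R z x \<and> R u x" "R z y \<and> R u y"
    using twice_map[OF z(2) assms(3)] .
  have "{u, x, z, y} \<subseteq> insert u (set vs)" "distinct [u, x, z, y]"
    "R u x" "R x z" "R z y" "R y u"
    using xy z assms(1,2,4) by (auto dest: sympD irreflpD)
  then show ?thesis
    unfolding four_cycle_def by blast
qed

lemma wheel_atD:
  assumes R: "symp R" "irreflp R" and "distinct vs" "u \<notin> set vs"
    and "wheel_at (adjacency R vs) (map (R u) vs)"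
  shows "wheel R (insert u (set vs))"
proof -
  obtain i j where ij: "i < length vs" "j < length vs" "i \<noteq> j" "R u (vs ! i)"
    "R u (vs ! j) \<or> R (vs ! i) (vs ! j)"
    "twice (map (\<lambda>x. R (vs ! i) x \<and> R (vs ! j) x \<and> R u x) vs)"
    using assms(5) by (auto simp: wheel_at_def adjacency_nth list_ex_iff meet_map)
  define x y where "x = vs ! i" and "y = vs ! j"
  have xy: "x \<noteq> y" "x \<in> set vs" "y \<in> set vs" "R u x" "R u y \<or> R x y"
    using ij assms(3) by (auto simp: x_def y_def nth_eq_iff_index_eq)
  obtain p q where pq: "p \<noteq> q" "p \<in> set vs" "q \<in> set vs"
    "R x p \<and> R y p \<and> R u p" "R x q \<and> R y q \<and> R u q"
    using twice_map[OF ij(6) assms(3)] unfolding x_def y_def by blast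
  \<comment> \<open>If \<open>u\<close> is joined to \<open>y\<close>, then \<open>u\<close> is the
    hub of the rim \<open>x p y q\<close>; otherwise \<open>x\<close> is the hub of the rim
    \<open>u p y q\<close>.\<close>
  show ?thesis
  proof (cases "R u y")
    case True
    have "u \<noteq> x" using xy assms(4) by auto
    with True show ?thesis
      using xy pq sympD[OF R(1)]
      by (intro wheelI[OF R, of u x p y q]) auto
  next
    case False
    have "u \<noteq> y" using xy assms(4) by auto
    with False show ?thesis
      using xy pq sympD[OF R(1)]
      by (intro wheelI[OF R, of x u p y q]) auto
  qed
qed

lemma set_rows: "set (rows n) = {bs. length bs = n}"
proof (induction n)
  case (Suc n)
  show ?case
    by (auto simp: Suc length_Suc_conv image_iff)
qed auto

definition realizes :: "('a \<Rightarrow> 'a \<Rightarrow> bool) \<Rightarrow> 'a set \<Rightarrow> bool list list \<Rightarrow> bool" where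
  "realizes R S M \<longleftrightarrow> (\<exists>vs. distinct vs \<and> set vs = S \<and> adjacency R vs = M)"

lemma realizes_permute:
  assumes "realizes R S M" "permutes_length p (length M)"
  shows "realizes R S (permute p M)"
proof -
  obtain vs where vs: "distinct vs" "set vs = S" "adjacency R vs = M"
    using assms(1) by (auto simp: realizes_def)
  have p: "length p = length vs" "distinct p" "\<forall>i \<in> set p. i < length vs"
    using assms(2) vs(3) by (auto simp: permutes_length_def list_all_iff)
  have sp: "set p = {..<length vs}"
    using p by (intro card_subset_eq) (auto simp: distinct_card)
  let ?ws = "map ((!) vs) p"
  have "distinct ?ws"
    using p vs(1) by (auto simp: distinct_map inj_on_def nth_eq_iff_index_eq)
  moreover have "set ?ws = S"
    unfolding set_map sp vs(2)[symmetric] by (auto simp: set_conv_nth)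
  moreover have "adjacency R ?ws = permute p M"
    using p unfolding vs(3)[symmetric]
    by (auto simp: adjacency_def permute_def o_def)
  ultimately show ?thesis
    unfolding realizes_def by blast
qed

lemma prune_subset: "set acc \<subseteq> set (prune Es ps acc)"
  by (induction Es ps acc rule: prune.induct) auto

text \<open>A matrix is dropped only if a renumbering of it is already listed, and the renumbered
  matrix is realized by the same vertex set. This holds whatever the hints are.\<close>

lemma prune_realizes:
  assumes "realizes R S E" "E \<in> set Es \<union> set acc"
  shows "\<exists>M \<in> set (prune Es ps acc). realizes R S M"
  using assms
proof (induction Es ps acc rule: prune.induct)
  case (3 E' Es p ps acc)
  then show ?case
    using realizes_permute[of R S E' p] prune_subset[of acc Es ps]
    by (auto split: if_splits)
qed auto

definition enumerated :: "('a \<Rightarrow> 'a \<Rightarrow> bool) \<Rightarrow> 'a set \<Rightarrow> nat \<Rightarrow> bool list list list \<Rightarrow> bool" where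
  "enumerated R N n L \<longleftrightarrow> (\<forall>S \<subseteq> N. card S = n \<longrightarrow> (\<exists>M \<in> set L. realizes R S M))"

text \<open>Removing a vertex from a set of \<open>Suc n\<close> vertices leaves a set whose matrix
  is listed. The row of the removed vertex passes both tests, since \<open>N\<close> contains
  neither a 4-cycle nor a wheel in the complement.\<close>

lemma enumerated_Suc:
  assumes R: "symp R" "irreflp R" and free: "\<not> four_cycle R N" "\<not> wheel (co R) N"
    and fin: "finite N" and L: "enumerated R N n L"
  shows "enumerated R N (Suc n) (prune (concat (map extensions L)) ps [])"
  unfolding enumerated_def
proof (intro allI impI)
  fix S assume S: "S \<subseteq> N" "card S = Suc n"
  then obtain u S' where u: "S = insert u S'" "u \<notin> S'" "card S' = n"
    by (meson card_Suc_eq)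
  then obtain M where M: "M \<in> set L" "realizes R S' M"
    using L S unfolding enumerated_def by blast
  then obtain vs where vs: "distinct vs" "set vs = S'" "adjacency R vs = M"
    by (auto simp: realizes_def)
  let ?r = "map (R u) vs"
  have u': "u \<notin> set vs" using u vs by simp
  have ins: "insert u (set vs) \<subseteq> N" using u S vs by simp
  have Not: "map Not ?r = map (co R u) vs"
    using u' by auto
  have "\<not> four_cycle_at M ?r"
    using four_cycle_atD[OF R vs(1) u'] four_cycle_mono[OF _ ins] free(1) vs(3) by blast
  moreover have "\<not> wheel_at (complement M) (map Not ?r)"
    using wheel_atD[OF symp_co[OF R(1)] irreflp_co vs(1) u'] wheel_mono[OF _ ins] free(2)
    unfolding Not vs(3)[symmetric] complement_adjacency[OF vs(1)] by blast
  ultimately have "extend M ?r \<in> set (extensions M)"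
    using vs(3) by (auto simp: extensions_def good_rows_def set_rows)
  then have "extend M ?r \<in> set (concat (map extensions L)) \<union> set []"
    using M(1) by auto
  moreover have "realizes R S (extend M ?r)"
    unfolding realizes_def using vs u u' adjacency_snoc[OF R, of vs u]
    by (intro exI[of _ "vs @ [u]"]) auto
  ultimately show "\<exists>M \<in> set (prune (concat (map extensions L)) ps []). realizes R S M"
    using prune_realizes by blast
qed

lemma enumerated_classes:
  assumes "symp R" "irreflp R" "\<not> four_cycle R N" "\<not> wheel (co R) N" "finite N"
    and "enumerated R N n L"
  shows "enumerated R N (n + length pss) (classes pss L)"
  using assms(6)
proof (induction pss L arbitrary: n rule: classes.induct)
  case (2 ps pss L)
  show ?case
    using "2.IH"[OF enumerated_Suc[OF assms(1-5) "2.prems"]] by simp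
qed auto

lemma enumerated_one: "irreflp R \<Longrightarrow> enumerated R N 1 [[[False]]]"
  unfolding enumerated_def realizes_def
  by (auto simp: card_1_singleton_iff adjacency_def irreflp_def intro!: exI[of _ "[_]"])

section \<open>Two colors: 15 vertices force a monochromatic wheel\<close>

definition blocked :: "bool list list \<Rightarrow> bool list \<Rightarrow> bool" where
  "blocked M r \<longleftrightarrow> wheel_at M r \<or> wheel_at (complement M) (map Not r)"

text \<open>\<open>r\<close> and \<open>s\<close> are the rows of two new vertices and
  \<open>b\<close> is the color of the pair they form: the rows exclude each other if both values of
  \<open>b\<close> lead to a wheel.\<close>

definition clash :: "bool list list \<Rightarrow> bool list \<Rightarrow> bool list \<Rightarrow> bool" where
  "clash M r s \<longleftrightarrow> list_all (\<lambda>b. blocked (extend M r) (s @ [b])) [False, True]"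

definition nine :: "bool list list" where
  "nine = extend eight (replicate 8 True)"

definition nine_rows :: "bool list list" where
  "nine_rows =
   [[True, True, False, False, True, True, False, False, False],
    [True, False, True, False, False, False, True, True, False],
    [False, True, False, True, False, True, True, False, False],
    [False, True, False, False, True, True, True, False, False],
    [False, False, True, True, True, False, False, True, False],
    [False, False, True, False, True, False, True, True, False]]"

text \<open>Evaluation of all 512 ways to join a tenth vertex to the nine vertices.\<close>

lemma nine_rows_complete: "filter (\<lambda>r. \<not> blocked nine r) (rows 9) = nine_rows"
  by code_simp

lemma nine_rows_clash:
  "list_all (\<lambda>r. clash nine r r) nine_rows \<and> clash nine (nine_rows ! 0) (nine_rows ! 1)"
  by code_simp

text \<open>Handshake parity: the ordered pairs split into blocks formed by a pair and its reversal,
  which differ by irreflexivity. This excludes a 7-regular graph on 15 vertices.\<close>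

lemma even_card_symmetric:
  assumes "finite W" "symp R" "irreflp R"
  shows "even (card {(x, y). x \<in> W \<and> y \<in> W \<and> R x y})"
proof -
  let ?P = "{(x, y). x \<in> W \<and> y \<in> W \<and> R x y}"
  let ?C = "(\<lambda>(x, y). {(x, y), (y, x)}) ` ?P"
  have "finite ?P"
    by (rule finite_subset[of _ "W \<times> W"]) (use assms(1) in auto)
  moreover have "\<Union>?C = ?P"
    using assms(2) by (auto dest: sympD)
  moreover have "\<forall>c \<in> ?C. 2 dvd card c"
  proof
    fix c assume "c \<in> ?C"
    then obtain x y where "R x y" "c = {(x, y), (y, x)}"
      by blast
    moreover from this have "x \<noteq> y"
      using assms(3) by (auto dest: irreflpD)
    ultimately show "2 dvd card c"
      by simp
  qed
  moreover have "\<forall>c \<in> ?C. \<forall>c' \<in> ?C. c \<noteq> c' \<longrightarrow> c \<inter> c' = {}"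
    by auto
  ultimately show ?thesis
    using dvd_partition[of ?C 2] by simp
qed

lemma blockedD:
  assumes R: "symp R" "irreflp R" and "distinct vs" "u \<notin> set vs"
    and "blocked (adjacency R vs) (map (R u) vs)"
  shows "wheel R (insert u (set vs)) \<or> wheel (co R) (insert u (set vs))"
proof -
  have "map Not (map (R u) vs) = map (co R u) vs"
    using assms(4) by auto
  with assms(5) have "wheel_at (adjacency R vs) (map (R u) vs) \<or>
      wheel_at (adjacency (co R) vs) (map (co R u) vs)"
    unfolding blocked_def complement_adjacency[OF assms(3)] by metis
  then show ?thesis
    using wheel_atD[OF R assms(3,4)] wheel_atD[OF symp_co[OF R(1)] irreflp_co assms(3,4)]
    by blast
qed

lemma clashD:
  assumes R: "symp R" "irreflp R" and d: "distinct vs" "u \<notin> set vs" "w \<notin> set vs" "u \<noteq> w"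
    and "clash (adjacency R vs) (map (R u) vs) (map (R w) vs)"
  shows "wheel R (insert w (insert u (set vs))) \<or> wheel (co R) (insert w (insert u (set vs)))"
proof -
  have "blocked (adjacency R (vs @ [u])) (map (R w) (vs @ [u]))"
    using assms(7) unfolding clash_def adjacency_snoc[OF R] by (cases "R w u") auto
  then show ?thesis
    using blockedD[OF R, of "vs @ [u]" w] d by auto
qed

lemma wheel_of_degree_eight:
  assumes R: "symp R" "irreflp R" and V: "finite V" "card V = 15"
    and v: "v \<in> V" "card {x \<in> V. R v x} \<ge> 8"
  shows "wheel R V \<or> wheel (co R) V"
proof (rule ccontr)
  assume "\<not> ?thesis"
  then have free: "\<not> wheel R V" "\<not> wheel (co R) V" by auto
  obtain N where N: "N \<subseteq> {x \<in> V. R v x}" "card N = 8" "finite N"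
    using obtain_subset_with_card_n[OF v(2)] by blast
  have vN: "v \<notin> N" using N R(2) by (auto dest: irreflpD)
  \<comment> \<open>Together with the hub \<open>v\<close>, a 4-cycle among the neighbors of
    \<open>v\<close> would be a wheel.\<close>
  have no4: "\<not> four_cycle R N"
  proof
    assume "four_cycle R N"
    then obtain a b c d where "{a, b, c, d} \<subseteq> N" "distinct [a, b, c, d]"
      "R a b" "R b c" "R c d" "R d a"
      unfolding four_cycle_def by blast
    then have "wheel R V"
      using N vN v(1) by (intro wheelI[OF R, of v a b c d]) auto
    with free show False by blast
  qed
  have now: "\<not> wheel (co R) N"
    using free(2) wheel_mono[of "co R" N V] N(1) by blast
  have "enumerated R N 8 [eight]"
    using enumerated_classes[OF R no4 now N(3) enumerated_one[OF R(2)], of hints]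
    by (simp add: classes_eight)
  then obtain ns where ns: "distinct ns" "set ns = N" "adjacency R ns = eight"
    using N(2) unfolding enumerated_def realizes_def by auto
  define vs where "vs = ns @ [v]"
  have len: "length ns = 8" using ns N(2) by (metis distinct_card)
  have "map (R v) ns = replicate 8 True"
    using N(1) ns(2) len by (intro nth_equalityI) auto
  then have adj: "adjacency R vs = nine"
    unfolding vs_def nine_def adjacency_snoc[OF R] ns(3) by simp
  have vs: "distinct vs" "set vs = insert v N" "length vs = 9" "set vs \<subseteq> V"
    using ns vN v(1) N(1) len by (auto simp: vs_def)
  define U where "U = V - set vs"
  define row where "row = (\<lambda>u. map (R u) vs)"
  have "card U = 6"
    using vs V distinct_card[OF vs(1)] N(3) by (simp add: U_def card_Diff_subset)
  have row: "row ` U \<subseteq> set nine_rows"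
  proof
    fix r assume "r \<in> row ` U"
    then obtain u where u: "u \<in> U" "r = row u" by blast
    have "\<not> blocked nine (row u)"
      using blockedD[OF R vs(1), of u] free wheel_mono[of _ "insert u (set vs)" V] u(1) vs(4)
      unfolding adj row_def U_def by blast
    moreover have "row u \<in> set (rows 9)"
      using vs(3) by (simp add: set_rows row_def)
    ultimately show "r \<in> set nine_rows"
      unfolding nine_rows_complete[symmetric] u(2) by simp
  qed
  have noclash: "\<not> clash nine (row u) (row w)" if "u \<in> U" "w \<in> U" "u \<noteq> w" for u w
    using clashD[OF R vs(1), of u w] free wheel_mono[of _ "insert w (insert u (set vs))" V] that vs(4)
    unfolding adj row_def U_def by blast
  have "inj_on row U"
  proof (rule inj_onI, rule ccontr)
    fix u w assume uw: "u \<in> U" "w \<in> U" "row u = row w" "u \<noteq> w"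
    have "clash nine (row u) (row u)"
      using nine_rows_clash row uw(1) by (auto simp: list_all_iff)
    then show False
      using noclash[OF uw(1,2,4)] uw(3) by simp
  qed
  then have "card (row ` U) = 6"
    using \<open>card U = 6\<close> by (simp add: card_image)
  moreover have "card (set nine_rows) \<le> 6"
    using card_length[of nine_rows] by (simp add: nine_rows_def)
  \<comment> \<open>Six outer vertices with distinct rows use up all six possible rows, among them
    the two that exclude each other.\<close>
  ultimately have eq: "row ` U = set nine_rows"
    using row by (intro card_seteq) auto
  have "nine_rows ! 0 \<in> row ` U" "nine_rows ! 1 \<in> row ` U" "nine_rows ! 0 \<noteq> nine_rows ! 1"
    unfolding eq by (auto simp: nine_rows_def)
  then obtain u w where "u \<in> U" "w \<in> U" "row u = nine_rows ! 0" "row w = nine_rows ! 1" "u \<noteq> w"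
    by (metis imageE)
  then show False
    using noclash[of u w] nine_rows_clash by simp
qed

text \<open>In a set of 15 vertices each one has 14 neighbors. If none had eight in one color, all
  red degrees would be 7, and their sum \<open>15 * 7\<close> would be odd.\<close>

theorem ramsey_wheel_two_colors:
  assumes R: "symp R" "irreflp R" and V: "finite V" "card V \<ge> 15"
  shows "wheel R V \<or> wheel (co R) V"
proof -
  obtain W where W: "W \<subseteq> V" "card W = 15" "finite W"
    using obtain_subset_with_card_n[OF V(2)] by blast
  have "\<exists>v \<in> W. card {x \<in> W. R v x} \<ge> 8 \<or> card {x \<in> W. co R v x} \<ge> 8"
  proof (rule ccontr)
    assume neg: "\<not> ?thesis"
    have deg: "card {x \<in> W. R v x} = 7" if "v \<in> W" for v
    proof -
      have "W = insert v ({x \<in> W. R v x} \<union> {x \<in> W. co R v x})"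
        using that by auto
      moreover have "v \<notin> {x \<in> W. R v x} \<union> {x \<in> W. co R v x}"
        using R(2) by (auto dest: irreflpD)
      moreover have "card ({x \<in> W. R v x} \<union> {x \<in> W. co R v x}) =
          card {x \<in> W. R v x} + card {x \<in> W. co R v x}"
        using W(3) by (intro card_Un_disjoint) auto
      ultimately have "15 = Suc (card {x \<in> W. R v x} + card {x \<in> W. co R v x})"
        using W(2,3) by (metis (no_types, lifting) card_insert_disjoint finite_insert)
      then show ?thesis
        using neg that by (auto simp: not_le)
    qed
    have "{(x, y). x \<in> W \<and> y \<in> W \<and> R x y} = Sigma W (\<lambda>x. {y \<in> W. R x y})"
      by auto
    then have "card {(x, y). x \<in> W \<and> y \<in> W \<and> R x y} = 15 * 7"
      using W(2,3) deg by simp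
    then show False
      using even_card_symmetric[OF W(3) R] by simp
  qed
  then obtain v where v: "v \<in> W" "card {x \<in> W. R v x} \<ge> 8 \<or> card {x \<in> W. co R v x} \<ge> 8"
    by blast
  \<comment> \<open>If the eight neighbors are blue, the roles of the colors are exchanged.\<close>
  have "co (co R) = R"
    using R(2) by (auto simp: fun_eq_iff dest: irreflpD)
  then have "wheel R W \<or> wheel (co R) W"
    using v wheel_of_degree_eight[OF R W(3,2) v(1)]
      wheel_of_degree_eight[OF symp_co[OF R(1)] irreflp_co W(3,2) v(1)] by auto
  then show ?thesis
    using wheel_mono[OF _ W(1)] by blast
qed

section \<open>Gallai partitions\<close>

definition symmetric :: "('a \<Rightarrow> 'a \<Rightarrow> 'c) \<Rightarrow> bool" where
  "symmetric c \<longleftrightarrow> (\<forall>x y. c x y = c y x)"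

definition gallai :: "('a \<Rightarrow> 'a \<Rightarrow> 'c) \<Rightarrow> 'a set \<Rightarrow> bool" where
  "gallai c V \<longleftrightarrow> (\<forall>x \<in> V. \<forall>y \<in> V. \<forall>z \<in> V. x \<noteq> y \<longrightarrow> y \<noteq> z \<longrightarrow> x \<noteq> z \<longrightarrow>
     c x y = c y z \<or> c y z = c x z \<or> c x y = c x z)"

lemma gallai_subset: "gallai c V \<Longrightarrow> W \<subseteq> V \<Longrightarrow> gallai c W"
  unfolding gallai_def by blast

definition colors :: "('a \<Rightarrow> 'a \<Rightarrow> 'c) \<Rightarrow> 'a set \<Rightarrow> 'c set" where
  "colors c V = {c x y | x y. x \<in> V \<and> y \<in> V \<and> x \<noteq> y}"

lemma finite_colors: "finite V \<Longrightarrow> finite (colors c V)"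
  unfolding colors_def
  by (rule finite_subset[of _ "(\<lambda>(x, y). c x y) ` (V \<times> V)"]) auto

lemma colors_mono: "W \<subseteq> V \<Longrightarrow> colors c W \<subseteq> colors c V"
  unfolding colors_def by blast

section \<open>Components with respect to a set of colors\<close>

definition adj_in :: "('a \<Rightarrow> 'a \<Rightarrow> 'c) \<Rightarrow> 'a set \<Rightarrow> 'c set \<Rightarrow> 'a \<Rightarrow> 'a \<Rightarrow> bool" where
  "adj_in c V G x y \<longleftrightarrow> x \<in> V \<and> y \<in> V \<and> x \<noteq> y \<and> c x y \<in> G"

abbreviation connected_in :: "('a \<Rightarrow> 'a \<Rightarrow> 'c) \<Rightarrow> 'a set \<Rightarrow> 'c set \<Rightarrow> 'a \<Rightarrow> 'a \<Rightarrow> bool" where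
  "connected_in c V G \<equiv> (adj_in c V G)\<^sup>*\<^sup>*"

lemma connected_in_sym: "symmetric c \<Longrightarrow> connected_in c V G x y \<Longrightarrow> connected_in c V G y x"
  by (rule sympD[OF symp_rtranclp]) (auto simp: symp_def adj_in_def symmetric_def)

text \<open>Along an edge \<open>y y'\<close> with color in \<open>G\<close>, both edges to
  \<open>z\<close> have colors outside \<open>G\<close>, because \<open>z\<close> lies in another
  component. As the triangle is not rainbow, these two colors agree.\<close>

lemma homogeneous_components:
  assumes "symmetric c" "gallai c V" "connected_in c V G x y"
    and "x \<in> V" "z \<in> V" "\<not> connected_in c V G x z"
  shows "c x z = c y z"
  using assms(3)
proof (induction rule: rtranclp_induct)
  case (step y y')
  have ne: "\<not> connected_in c V G y z" "\<not> connected_in c V G y' z"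
    using step.hyps assms(6) by (meson rtranclp.rtrancl_into_rtrancl rtranclp_trans)+
  have "y \<in> V" "y' \<in> V" "y \<noteq> y'" "c y y' \<in> G" "y \<noteq> z" "y' \<noteq> z"
    using step.hyps(2) ne by (auto simp: adj_in_def)
  moreover have "c y z \<notin> G" "c y' z \<notin> G"
    using ne calculation assms(5) by (metis adj_in_def r_into_rtranclp)+
  ultimately have "c y z = c y' z"
    using assms(2,5) unfolding gallai_def by metis
  with step.IH show ?case by simp
qed simp

text \<open>A path to \<open>v\<close> is cut off at its first visit to \<open>v\<close>.\<close>

lemma connected_in_remove:
  assumes "connected_in c (insert v W) G x v" "x \<in> W" "v \<notin> W"
  shows "\<exists>x'. connected_in c W G x x' \<and> x' \<in> W \<and> c x' v \<in> G"
  using assms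
proof (induction rule: converse_rtranclp_induct)
  case (step x y)
  show ?case
  proof (cases "y = v")
    case True
    then show ?thesis
      using step.hyps(1) step.prems by (auto simp: adj_in_def)
  next
    case False
    then have "y \<in> W" "adj_in c W G x y"
      using step.hyps(1) step.prems by (auto simp: adj_in_def)
    then show ?thesis
      using step.IH step.prems(2) by (meson converse_rtranclp_into_rtranclp)
  qed
qed simp

lemma connected_in_first:
  assumes "connected_in c V G x y" "x \<noteq> y"
  obtains z where "z \<in> V" "z \<noteq> x" "c x z \<in> G"
  using assms by (metis adj_in_def converse_rtranclpE)

lemma two_elements:
  assumes "card A \<ge> 2"
  obtains x y where "x \<in> A" "y \<in> A" "x \<noteq> y"
proof -
  obtain B where "B \<subseteq> A" "card B = 2"
    using obtain_subset_with_card_n[OF assms] by blast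
  then show ?thesis
    using that by (auto simp: card_2_iff)
qed

text \<open>Gallai's theorem in the form that three or more colors cannot all be connected. The
  induction removes a vertex \<open>v\<close>: either three colors survive on \<open>W\<close> and
  one of them, \<open>g\<close>, is disconnected there, or some color occurs only at
  \<open>v\<close>.\<close>

lemma disconnected_color:
  assumes "finite V" "symmetric c" "gallai c V" "card (colors c V) \<ge> 3"
  shows "\<exists>g \<in> colors c V. \<exists>x \<in> V. \<exists>y \<in> V. \<not> connected_in c V {g} x y"
  using assms(1,3,4)
proof (induction V rule: finite_induct)
  case (insert v W)
  let ?V = "insert v W"
  have sym: "c x y = c y x" for x y
    using assms(2) by (simp add: symmetric_def)
  show ?case
  proof (rule ccontr)
    assume "\<not> ?case"
    then have conn: "connected_in c ?V {g} x y"
      if "g \<in> colors c ?V" "x \<in> ?V" "y \<in> ?V" for g x y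
      using that by blast
    obtain w0 where w0: "w0 \<in> W"
      using insert.prems(2) by (cases "W = {}") (auto simp: colors_def)
    have star: "\<exists>w \<in> W. c v w = g" if "g \<in> colors c ?V" for g
    proof -
      have "v \<noteq> w0" using w0 insert.hyps(2) by blast
      then show ?thesis
        using connected_in_first[OF conn[OF that, of v w0]] w0 by blast
    qed
    show False
    proof (cases "card (colors c W) \<ge> 3")
      case True
      then obtain g x0 y0 where g: "g \<in> colors c W" "x0 \<in> W" "y0 \<in> W"
        "\<not> connected_in c W {g} x0 y0"
        using insert.IH gallai_subset[OF insert.prems(1)] by blast
      have gV: "g \<in> colors c ?V"
        using g(1) colors_mono[of W ?V c] by blast
      have galW: "gallai c W"
        using gallai_subset[OF insert.prems(1)] by blast
      \<comment> \<open>Since \<open>g\<close> is connected on the whole set, the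
        \<open>g\<close>-component of \<open>x\<close> contains an \<open>x'\<close> joined to
        \<open>v\<close> in \<open>g\<close>. The triangle \<open>v w x'\<close> then forces
        \<open>c w x' = c v w\<close>, and homogeneity carries this over to
        \<open>x\<close>.\<close>
      have cut: "c w x = c v w"
        if wx: "w \<in> W" "x \<in> W" "c v w \<noteq> g" "\<not> connected_in c W {g} w x" for w x
      proof -
        obtain x' where x': "connected_in c W {g} x x'" "x' \<in> W" "c x' v \<in> {g}"
          using connected_in_remove[OF conn[OF gV, of x v] wx(2) insert.hyps(2)] wx(2) by blast
        have nc: "\<not> connected_in c W {g} w x'"
          using wx(4) x'(1) connected_in_sym[OF assms(2)] by (meson rtranclp_trans)
        then have "w \<noteq> x'" "c w x' \<noteq> g"
          using wx(1) x'(2) r_into_rtranclp[of "adj_in c W {g}" w x'] by (auto simp: adj_in_def)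
        moreover have "v \<noteq> w" "v \<noteq> x'"
          using wx(1) x'(2) insert.hyps(2) by auto
        ultimately have "c v w = c w x' \<or> c w x' = c v x' \<or> c v w = c v x'"
          using insert.prems(1) wx(1) x'(2) unfolding gallai_def by blast
        then have "c w x' = c v w"
          using \<open>c w x' \<noteq> g\<close> wx(3) x'(3) sym[of v x'] by auto
        moreover have "c x w = c x' w"
          using homogeneous_components[OF assms(2) galW x'(1) wx(2,1)] wx(4)
            connected_in_sym[OF assms(2)] by blast
        ultimately show ?thesis
          using sym by metis
      qed
      have "card (colors c ?V - {g}) \<ge> 2"
        using insert.prems(2) gV by simp
      then obtain h l where hl: "h \<in> colors c ?V" "l \<in> colors c ?V" "h \<noteq> g" "l \<noteq> g" "h \<noteq> l"
        by (rule two_elements) blast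
      obtain w w' where w: "w \<in> W" "c v w = h" "w' \<in> W" "c v w' = l"
        using star hl by meson
      \<comment> \<open>For \<open>w\<close>, \<open>w'\<close> in different
        \<open>g\<close>-components, \<open>c w w'\<close> would be both \<open>h\<close> and
        \<open>l\<close>. Otherwise a vertex \<open>x\<close> of another component is joined to
        \<open>w\<close> and \<open>w'\<close> in equal colors, which again would be
        \<open>h\<close> and \<open>l\<close>.\<close>
      show False
      proof (cases "connected_in c W {g} w w'")
        case False
        then have "\<not> connected_in c W {g} w' w"
          using connected_in_sym[OF assms(2)] by blast
        then show False
          using cut[of w w'] cut[of w' w] False w hl sym by metis
      next
        case True
        obtain x where x: "x \<in> W" "\<not> connected_in c W {g} w x"
          using g connected_in_sym[OF assms(2)] by (meson rtranclp_trans)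
        then have "\<not> connected_in c W {g} w' x"
          using True by (meson rtranclp_trans)
        then show False
          using homogeneous_components[OF assms(2) galW True w(1) x] cut[of w x] cut[of w' x]
            w x hl by auto
      qed
    next
      case False
      then have "\<not> colors c ?V \<subseteq> colors c W"
        using insert.prems(2) card_mono[OF finite_colors[OF insert.hyps(1), of c]]
        by (metis le_trans)
      \<comment> \<open>All edges of color \<open>l\<close> contain \<open>v\<close>. As
        \<open>l\<close> is connected, every vertex of \<open>W\<close> is joined to
        \<open>v\<close> in \<open>l\<close>, which leaves no room for a second color at
        \<open>v\<close>.\<close>
      then obtain l where l: "l \<in> colors c ?V" "l \<notin> colors c W" by blast
      have "card (colors c ?V - {l}) \<ge> 2"
        using insert.prems(2) l by simp
      then obtain g where g: "g \<in> colors c ?V" "g \<noteq> l"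
        by (metis Diff_iff card.empty ex_in_conv insertCI not_numeral_le_zero)
      obtain y where y: "y \<in> W" "c v y = g"
        using star g by blast
      have "y \<noteq> v" using y insert.hyps(2) by blast
      then obtain z where "z \<in> ?V" "z \<noteq> y" "c y z \<in> {l}"
        using connected_in_first[OF conn[OF l(1), of y v]] y(1) by blast
      then show False
        using l(2) y g sym unfolding colors_def by blast
    qed
  qed
qed (simp add: colors_def)

lemma subset_doubleton:
  assumes "finite A" "card A \<le> 2"
  obtains a b where "A \<subseteq> {a, b}"
proof -
  consider "card A = 0" | "card A = 1" | "card A = 2"
    using assms(2) by linarith
  then show ?thesis
    using that assms(1) by cases (auto simp: card_1_singleton_iff card_2_iff)
qed

text \<open>The classes of \<open>E\<close> are the components of a maximal color set
  \<open>G\<close> that leaves \<open>V\<close> disconnected. If three colors occurred between the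
  classes, one of them would be disconnected on a set of representatives and could be added to
  \<open>G\<close>.\<close>

theorem gallai_partition:
  assumes V: "finite V" "card V \<ge> 2" and c: "symmetric c" "gallai c V"
  obtains E r b where "equivp E" "\<exists>x \<in> V. \<exists>y \<in> V. \<not> E x y"
    and "\<And>x y z. x \<in> V \<Longrightarrow> z \<in> V \<Longrightarrow> E x y \<Longrightarrow> \<not> E x z \<Longrightarrow> c x z = c y z"
    and "\<And>x y. x \<in> V \<Longrightarrow> y \<in> V \<Longrightarrow> \<not> E x y \<Longrightarrow> c x y \<in> {r, b}"
proof -
  let ?bad = "\<lambda>G. G \<subseteq> colors c V \<and> (\<exists>x \<in> V. \<exists>y \<in> V. \<not> connected_in c V G x y)"
  have "finite {G. ?bad G}"
    by (rule finite_subset[of _ "Pow (colors c V)"]) (auto simp: finite_colors[OF V(1)])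
  moreover have "?bad {}"
  proof -
    obtain x y where "x \<in> V" "y \<in> V" "x \<noteq> y"
      using two_elements[OF V(2)] .
    moreover have "\<not> adj_in c V {} a d" for a d
      by (simp add: adj_in_def)
    ultimately show ?thesis
      by (metis converse_rtranclpE empty_subsetI)
  qed
  ultimately have "\<exists>G \<in> {G. ?bad G}. \<forall>G' \<in> {G. ?bad G}. G \<subseteq> G' \<longrightarrow> G = G'"
    by (intro finite_has_maximal) blast+
  then obtain G where G: "?bad G" and max: "\<And>G'. ?bad G' \<Longrightarrow> G \<subseteq> G' \<Longrightarrow> G = G'"
    by (elim bexE) simp
  define E where "E = connected_in c V G"
  have eq: "equivp E"
    unfolding E_def
    by (intro equivpI reflpI sympI transpI) (auto intro: connected_in_sym[OF c(1)])
  have hom: "c x z = c y z" if "x \<in> V" "z \<in> V" "E x y" "\<not> E x z" for x y z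
    using homogeneous_components[OF c that(3)[unfolded E_def] that(1,2)] that(4) E_def by blast
  have sym: "c x y = c y x" for x y
    using c(1) by (simp add: symmetric_def)
  \<comment> \<open>A choice that depends only on the class: equivalent vertices satisfy the same
    predicate.\<close>
  define rep where "rep x = (SOME y. y \<in> V \<and> E x y)" for x
  have rep: "rep x \<in> V" "E x (rep x)" if "x \<in> V" for x
    using someI[of "\<lambda>y. y \<in> V \<and> E x y" x] that equivp_reflp[OF eq] unfolding rep_def by auto
  have rep_eq: "rep x = rep y" if "E x y" for x y
    using that eq unfolding rep_def equivp_def by metis
  have rep_col: "c x y = c (rep x) (rep y)" "\<not> E (rep x) (rep y)" if "x \<in> V" "y \<in> V" "\<not> E x y" for x y
  proof -
    show ne: "\<not> E (rep x) (rep y)"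
      using that rep eq by (meson equivp_symp equivp_transp)
    have "\<not> E y (rep x)"
      using that rep eq by (meson equivp_symp equivp_transp)
    then show "c x y = c (rep x) (rep y)"
      using hom[of x y "rep x"] hom[of y "rep x" "rep y"] that rep sym by metis
  qed
  let ?D = "rep ` V"
  have D: "?D \<subseteq> V" using rep by blast
  have idem: "rep x = x" if "x \<in> ?D" for x
    using that rep rep_eq by (metis imageE)
  have "card (colors c ?D) \<le> 2"
  proof (rule ccontr)
    assume "\<not> ?thesis"
    then obtain g x y where g: "g \<in> colors c ?D" "x \<in> ?D" "y \<in> ?D" "\<not> connected_in c ?D {g} x y"
      using disconnected_color[OF _ c(1) gallai_subset[OF c(2) D]] V(1) by fastforce
    then obtain a b where ab: "a \<in> ?D" "b \<in> ?D" "a \<noteq> b" "g = c a b"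
      unfolding colors_def by blast
    then have "\<not> E a b"
      using idem rep_eq by metis
    then have "g \<notin> G"
      using ab D unfolding E_def by (metis adj_in_def r_into_rtranclp subsetD)
    \<comment> \<open>Contracting the classes turns a path with colors in \<open>insert g G\<close>
      into a path of color \<open>g\<close> between representatives.\<close>
    have "connected_in c ?D {g} (rep u) (rep w)" if "connected_in c V (insert g G) u w" for u w
      using that
    proof (induction rule: rtranclp_induct)
      case (step w w')
      show ?case
      proof (cases "E w w'")
        case True
        then show ?thesis
          using step.IH rep_eq by metis
      next
        case False
        have "w \<in> V" "w' \<in> V" "w \<noteq> w'" "c w w' \<in> insert g G"
          using step.hyps(2) by (auto simp: adj_in_def)
        moreover from this have "c w w' \<notin> G"
          using False unfolding E_def by (metis adj_in_def r_into_rtranclp)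
        ultimately have "adj_in c ?D {g} (rep w) (rep w')"
          using rep_col[of w w'] False equivp_reflp[OF eq] unfolding adj_in_def by auto
        then show ?thesis
          using step.IH by simp
      qed
    qed simp
    then have "\<not> connected_in c V (insert g G) x y"
      using g idem by metis
    moreover have "g \<in> colors c V"
      using g(1) colors_mono[OF D, of c] by blast
    ultimately have "?bad (insert g G)"
      using G g(2,3) D by blast
    then show False
      using max \<open>g \<notin> G\<close> by blast
  qed
  then obtain r b where rb: "colors c ?D \<subseteq> {r, b}"
    using subset_doubleton V(1) finite_colors by (metis finite_imageI)
  have "c x y \<in> {r, b}" if "x \<in> V" "y \<in> V" "\<not> E x y" for x y
  proof -
    have "rep x \<noteq> rep y"
      using rep_col(2)[OF that] equivp_reflp[OF eq] by metis
    then show ?thesis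
      using rb rep_col(1)[OF that] that unfolding colors_def by blast
  qed
  then show thesis
    using that[OF eq _ hom] G unfolding E_def by blast
qed

section \<open>The upper bound\<close>

definition same :: "('a \<Rightarrow> 'a \<Rightarrow> 'c) \<Rightarrow> 'c \<Rightarrow> 'a \<Rightarrow> 'a \<Rightarrow> bool" where
  "same c i x y \<longleftrightarrow> x \<noteq> y \<and> c x y = i"

lemma symp_same: "symmetric c \<Longrightarrow> symp (same c i)"
  by (auto simp: symp_def same_def symmetric_def)

lemma irreflp_same: "irreflp (same c i)"
  by (auto simp: irreflp_def same_def)

text \<open>\<open>K\<close> is a palette: it contains the colors that occur on \<open>V\<close> and
  may contain more, so that the induction can run on the cardinality of \<open>K\<close>.\<close>

definition admissible :: "('a \<Rightarrow> 'a \<Rightarrow> 'c) \<Rightarrow> 'c set \<Rightarrow> 'a set \<Rightarrow> bool" where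
  "admissible c K V \<longleftrightarrow> finite V \<and> symmetric c \<and> gallai c V \<and> (\<forall>i. \<not> wheel (same c i) V) \<and>
     colors c V \<subseteq> K"

lemma admissible_subset: "admissible c K V \<Longrightarrow> W \<subseteq> V \<Longrightarrow> admissible c K W"
  unfolding admissible_def
  using finite_subset[of W V] gallai_subset[of c V W] wheel_mono[of _ W V] colors_mono[of W V c]
  by blast

lemma admissible_no_wheel:
  assumes "admissible c K V" "{h, p, q, s, t} \<subseteq> V" "distinct [h, p, q, s, t]"
    and "c h p = i" "c h q = i" "c h s = i" "c h t = i"
    and "c p q = i" "c q s = i" "c s t = i" "c t p = i"
  shows False
proof -
  have "wheel (same c i) V"
    unfolding wheel_def same_def using assms(2-)
    by (intro exI[of _ h] exI[of _ p] exI[of _ q] exI[of _ s] exI[of _ t]) auto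
  then show False
    using assms(1) by (simp add: admissible_def)
qed

section \<open>Colors that form a matching, and merging them into others\<close>

definition matching :: "('a \<Rightarrow> 'a \<Rightarrow> 'c) \<Rightarrow> 'c \<Rightarrow> 'a set \<Rightarrow> bool" where
  "matching c r A \<longleftrightarrow> (\<forall>x \<in> A. \<forall>y \<in> A. \<forall>z \<in> A. x \<noteq> y \<longrightarrow> y \<noteq> z \<longrightarrow> x \<noteq> z \<longrightarrow>
     \<not> (c x y = r \<and> c y z = r))"

lemma matching_subset: "matching c r A \<Longrightarrow> B \<subseteq> A \<Longrightarrow> matching c r B"
  unfolding matching_def by blast

text \<open>A monochromatic cut with two vertices \<open>p, q\<close> on one side: a path \<open>x y z\<close> of the
  same color on the other side gives a wheel with hub \<open>y\<close> and rim \<open>x p z q\<close>.\<close>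

lemma matching_of_cut:
  assumes adm: "admissible c K V" and AB: "A \<subseteq> V" "B \<subseteq> V" "A \<inter> B = {}" "card B \<ge> 2"
    and cut: "\<And>x y. x \<in> A \<Longrightarrow> y \<in> B \<Longrightarrow> c x y = r"
  shows "matching c r A"
  unfolding matching_def
proof (intro ballI impI notI)
  fix x y z
  assume x: "x \<in> A" "y \<in> A" "z \<in> A" "x \<noteq> y" "y \<noteq> z" "x \<noteq> z" "c x y = r \<and> c y z = r"
  obtain p q where pq: "p \<in> B" "q \<in> B" "p \<noteq> q"
    using two_elements[OF AB(4)] .
  have sym: "c u w = c w u" for u w
    using adm by (simp add: admissible_def symmetric_def)
  show False
    using x pq AB cut sym[of y x] sym[of p z] sym[of q x]
    by (intro admissible_no_wheel[OF adm, of y x p z q r]) auto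
qed

definition recolor :: "('a \<Rightarrow> 'a \<Rightarrow> 'c) \<Rightarrow> 'c \<Rightarrow> 'c \<Rightarrow> 'a \<Rightarrow> 'a \<Rightarrow> 'c" where
  "recolor c r j x y = (if c x y = r then j else c x y)"

text \<open>The ends of an edge of a matching color \<open>r\<close> are joined to every other vertex in equal
  colors. Hence a wheel of color \<open>j\<close> that uses edges of color \<open>r\<close> can be rerouted on its five
  vertices so as to avoid them.\<close>

lemma admissible_recolor:
  assumes adm: "admissible c K V" and r: "matching c r V" and j: "j \<in> K" "j \<noteq> r"
  shows "admissible (recolor c r j) (K - {r}) V"
proof -
  have sym: "c x y = c y x" for x y
    using adm by (simp add: admissible_def symmetric_def)
  have gal: "gallai c V" and fin: "finite V" and col: "colors c V \<subseteq> K"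
    using adm by (auto simp: admissible_def)
  have match: "c y z \<noteq> r" if "c x y = r" "{x, y, z} \<subseteq> V" "distinct [x, y, z]" for x y z
    using r that unfolding matching_def by auto
  have twins: "c x z = c y z" if "c x y = r" "{x, y, z} \<subseteq> V" "distinct [x, y, z]" for x y z
  proof -
    have "c y z \<noteq> r" "c x z \<noteq> r"
      using match[of x y z] match[of y x z] that sym[of x y] by auto
    moreover have "c x y = c y z \<or> c y z = c x z \<or> c x y = c x z"
      using gal that(2,3) unfolding gallai_def by simp
    ultimately show ?thesis using that(1) by auto
  qed
  have spoke: "c h p \<noteq> r"
    if w: "{h, p, q, s, t} \<subseteq> V" "distinct [h, p, q, s, t]"
      "recolor c r j h p = j" "recolor c r j h q = j" "recolor c r j h s = j" "recolor c r j h t = j"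
      "recolor c r j p q = j" "recolor c r j q s = j" "recolor c r j s t = j" "recolor c r j t p = j"
    for h p q s t
  proof
    assume hp: "c h p = r"
    have "c p q \<noteq> r" "c p t \<noteq> r" "c h q \<noteq> r" "c h s \<noteq> r" "c h t \<noteq> r"
      using hp match[of h p] match[of p h] w(1,2) sym[of h p] by auto
    then have e: "c h q = j" "c h s = j" "c h t = j" "c p q = j" "c p t = j"
      using w sym[of t p] by (auto simp: recolor_def split: if_splits)
    have ps: "c p s = j"
      using twins[of h p s] hp e w(1,2) by auto
    \<comment> \<open>By now \<open>h\<close> and \<open>p\<close> are both joined to
      \<open>q\<close>, \<open>s\<close>, \<open>t\<close> in color \<open>j\<close> and become
      opposite rim vertices. The new hub is a vertex among \<open>q\<close>, \<open>s\<close>,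
      \<open>t\<close> that is joined to the other two in color \<open>j\<close>.\<close>
    consider "c q s = r" | "c q s = j" "c s t = r" | "c q s = j" "c s t = j"
      using w by (auto simp: recolor_def split: if_splits)
    then show False
    proof cases
      case 1
      have "c s t \<noteq> r"
        using match[of q s t] 1 w(1,2) by auto
      then have st: "c s t = j"
        using w by (auto simp: recolor_def split: if_splits)
      have "c q t = j"
        using twins[of q s t] 1 st w(1,2) by auto
      then show False
        using w(1,2) e ps st
        by (intro admissible_no_wheel[OF adm, of t h q p s j]) (auto simp: sym)
    next
      case 2
      have "c q t = j"
        using twins[of s t q] 2 w(1,2) sym[of q s] sym[of q t] by auto
      then show False
        using w(1,2) e ps 2
        by (intro admissible_no_wheel[OF adm, of q h t p s j]) (auto simp: sym)
    next
      case 3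
      show False
        using w(1,2) e ps 3
        by (intro admissible_no_wheel[OF adm, of s h q p t j]) (auto simp: sym)
    qed
  qed
  have rim: "c p q \<noteq> r"
    if w: "{h, p, q, s, t} \<subseteq> V" "distinct [h, p, q, s, t]"
      "c h p = j" "c h q = j" "c h s = j" "c h t = j"
      "recolor c r j p q = j" "recolor c r j q s = j" "recolor c r j s t = j" "recolor c r j t p = j"
    for h p q s t
  proof
    assume pq: "c p q = r"
    have "c q s \<noteq> r" "c p t \<noteq> r"
      using pq match[of p q s] match[of q p t] w(1,2) sym[of p q] by auto
    then have e: "c q s = j" "c p t = j"
      using w sym[of t p] by (auto simp: recolor_def split: if_splits)
    \<comment> \<open>The rim is rerouted as \<open>p s q t\<close>, which avoids the pairs
      \<open>p q\<close> and \<open>s t\<close>.\<close>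
    have "c p s = j" "c q t = j"
      using twins[of p q s] twins[of p q t] pq e w(1,2) by auto
    then show False
      using w(1-6) e
      by (intro admissible_no_wheel[OF adm, of h p s q t j]) (auto simp: sym)
  qed
  have "\<not> wheel (same (recolor c r j) i) V" for i
  proof
    assume "wheel (same (recolor c r j) i) V"
    then obtain h p q s t where V: "{h, p, q, s, t} \<subseteq> V" "distinct [h, p, q, s, t]"
      and i: "recolor c r j h p = i" "recolor c r j h q = i" "recolor c r j h s = i"
        "recolor c r j h t = i" "recolor c r j p q = i" "recolor c r j q s = i"
        "recolor c r j s t = i" "recolor c r j t p = i"
      unfolding wheel_def same_def by blast
    show False
    proof (cases "i = j")
      case False
      then show False
        using i V
        by (intro admissible_no_wheel[OF adm, of h p q s t i])
          (auto simp: recolor_def split: if_splits)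
    next
      case True
      have i: "recolor c r j h p = j" "recolor c r j h q = j" "recolor c r j h s = j"
        "recolor c r j h t = j" "recolor c r j p q = j" "recolor c r j q s = j"
        "recolor c r j s t = j" "recolor c r j t p = j"
        using i True by auto
      have V': "{h, q, s, t, p} \<subseteq> V" "{h, s, t, p, q} \<subseteq> V" "{h, t, p, q, s} \<subseteq> V"
        "distinct [h, q, s, t, p]" "distinct [h, s, t, p, q]" "distinct [h, t, p, q, s]"
        using V by auto
      have "c h p \<noteq> r" "c h q \<noteq> r" "c h s \<noteq> r" "c h t \<noteq> r"
        using spoke[OF V i] spoke[OF V'(1,4) i(2,3,4,1,6,7,8,5)]
          spoke[OF V'(2,5) i(3,4,1,2,7,8,5,6)] spoke[OF V'(3,6) i(4,1,2,3,8,5,6,7)] by auto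
      then have k: "c h p = j" "c h q = j" "c h s = j" "c h t = j"
        using i by (auto simp: recolor_def)
      have "c p q \<noteq> r" "c q s \<noteq> r" "c s t \<noteq> r" "c t p \<noteq> r"
        using rim[OF V k i(5-8)] rim[OF V'(1,4) k(2,3,4,1) i(6,7,8,5)]
          rim[OF V'(2,5) k(3,4,1,2) i(7,8,5,6)] rim[OF V'(3,6) k(4,1,2,3) i(8,5,6,7)] by auto
      then have "c p q = j" "c q s = j" "c s t = j" "c t p = j"
        using i by (auto simp: recolor_def)
      then show False
        using admissible_no_wheel[OF adm V k] by blast
    qed
  qed
  moreover have "gallai (recolor c r j) V"
    using gal unfolding gallai_def recolor_def by metis
  moreover have "symmetric (recolor c r j)"
    using sym unfolding symmetric_def recolor_def by metis
  moreover have "colors (recolor c r j) V \<subseteq> K - {r}"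
    using col j unfolding colors_def recolor_def by auto
  ultimately show ?thesis
    using fin by (simp add: admissible_def)
qed

section \<open>The bound and its recursive inequalities\<close>

text \<open>The largest order without a monochromatic wheel, one less than the Gallai-Ramsey number.
  The value 4 for one color enters the induction at \<open>k = 3\<close> as
  \<open>bound (k - 2)\<close>.\<close>

definition bound :: "nat \<Rightarrow> nat" where
  "bound k = (if k = 1 then 4 else if even k then 14 * 5 ^ ((k - 2) div 2) else 28 * 5 ^ ((k - 3) div 2))"

lemma bound_simps [simp]: "bound (Suc 0) = 4" "bound 1 = 4" "bound 2 = 14" "bound 3 = 28"
  by (simp_all add: bound_def)

lemma bound_even: "bound (2 * m + 2) = 14 * 5 ^ m"
  by (simp add: bound_def)

lemma bound_odd: "bound (2 * m + 3) = 28 * 5 ^ m"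
  by (simp add: bound_def)

text \<open>The first inequality serves cuts with two large sides, the second the count of a class
  with its red and blue neighborhoods. The third leaves room for \<open>k\<close> peeled vertices
  and one more.\<close>

lemma bound_step:
  assumes "k \<ge> 3"
  shows "2 * bound (k - 1) \<le> bound k" "5 * bound (k - 2) \<le> bound k"
    and "bound (k - 1) + k + 1 \<le> bound k"
proof -
  have lin: "m + 1 \<le> 5 ^ m" for m :: nat
    by (induction m) auto
  have "2 * bound (k - 1) \<le> bound k \<and> 5 * bound (k - 2) \<le> bound k \<and> bound (k - 1) + k + 1 \<le> bound k"
  proof (cases "even k")
    case True
    then obtain n where n: "k = 2 * n"
      by (rule evenE)
    with assms have "n \<ge> 2"
      by simp
    then obtain m where "n = 2 + m"
      using le_Suc_ex by blast
    with n have m: "k = 2 * (m + 1) + 2"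
      by simp
    then have "bound (k - 1) = 28 * 5 ^ m" "bound (k - 2) = 14 * 5 ^ m" "bound k = 14 * 5 ^ (m + 1)"
      using bound_odd[of m] bound_even[of m] bound_even[of "m + 1"] by (auto simp: numeral_3_eq_3)
    then show ?thesis
      using lin[of m] m by simp
  next
    case False
    then have "k = 2 * ((k - 3) div 2) + 3"
      using assms by presburger
    then obtain m where m: "k = 2 * m + 3" ..
    then have eq: "bound (k - 1) = 14 * 5 ^ m" "bound k = 28 * 5 ^ m"
      using bound_odd[of m] bound_even[of m] by auto
    show ?thesis
    proof (cases m)
      case 0
      then show ?thesis using m by simp
    next
      case (Suc n)
      then have "bound (k - 2) = 28 * 5 ^ n"
        using bound_odd[of n] m by (simp add: numeral_3_eq_3)
      then show ?thesis
        using lin[of m] eq Suc m by simp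
    qed
  qed
  then show "2 * bound (k - 1) \<le> bound k" "5 * bound (k - 2) \<le> bound k"
    "bound (k - 1) + k + 1 \<le> bound k" by auto
qed

lemma bound_ge: "k \<ge> 1 \<Longrightarrow> bound k \<ge> k + 3"
proof (induction k rule: less_induct)
  case (less k)
  consider "k = 1" | "k = 2" | "k \<ge> 3"
    using less.prems by linarith
  then show ?case
  proof cases
    case 3
    then have "bound (k - 1) \<ge> k - 1 + 3"
      by (intro less.IH) auto
    then show ?thesis
      using bound_step(3)[OF 3] by simp
  qed auto
qed

lemma wheel_rel_mono:
  assumes "wheel R V" "\<And>x y. x \<in> V \<Longrightarrow> y \<in> V \<Longrightarrow> R x y \<Longrightarrow> Q x y"
  shows "wheel Q V"
proof -
  obtain h a b c d where "{h, a, b, c, d} \<subseteq> V" "distinct [h, a, b, c, d]"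
    "R h a" "R h b" "R h c" "R h d" "R a b" "R b c" "R c d" "R d a"
    using assms(1) unfolding wheel_def by blast
  then show ?thesis
    unfolding wheel_def using assms(2)
    by (intro exI[of _ h] exI[of _ a] exI[of _ b] exI[of _ c] exI[of _ d]) auto
qed

lemma card_one_color:
  assumes adm: "admissible c K V" and K: "card K = 1"
  shows "card V \<le> 4"
proof (rule ccontr)
  assume "\<not> card V \<le> 4"
  then obtain W where W: "W \<subseteq> V" "card W = 5"
    using obtain_subset_with_card_n[of 5 V] by auto
  then obtain ws where ws: "set ws = W" "distinct ws" "length ws = 5"
    by (metis distinct_card finite_distinct_list finite_subset adm admissible_def)
  then obtain h p q s t where hs: "ws = [h, p, q, s, t]"
    by (auto simp: numeral_eq_Suc length_Suc_conv)
  obtain i where i: "K = {i}"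
    using K by (rule card_1_singletonE)
  have "c x y = i" if "x \<in> W" "y \<in> W" "x \<noteq> y" for x y
    using adm that W(1) unfolding admissible_def i colors_def by blast
  then show False
    using ws hs W(1) by (intro admissible_no_wheel[OF adm, of h p q s t i]) auto
qed

lemma card_two_colors:
  assumes adm: "admissible c K V" and K: "K \<subseteq> {r, b}"
  shows "card V \<le> 14"
proof (rule ccontr)
  assume "\<not> card V \<le> 14"
  moreover have "symmetric c" "finite V"
    using adm by (auto simp: admissible_def)
  ultimately have "wheel (same c r) V \<or> wheel (co (same c r)) V"
    by (intro ramsey_wheel_two_colors symp_same irreflp_same) auto
  moreover have "wheel (same c b) V" if co: "wheel (co (same c r)) V"
  proof -
    have "same c b x y" if "x \<in> V" "y \<in> V" "co (same c r) x y" for x y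
      using adm K that unfolding admissible_def colors_def same_def by blast
    then show ?thesis
      using wheel_rel_mono[OF co] by blast
  qed
  ultimately show False
    using adm by (auto simp: admissible_def)
qed

text \<open>The type argument only names the types of vertices and colors that are quantified over.\<close>

definition bounded :: "('a \<Rightarrow> 'a \<Rightarrow> 'c) itself \<Rightarrow> nat \<Rightarrow> bool" where
  "bounded _ m \<longleftrightarrow> (\<forall>(c :: 'a \<Rightarrow> 'a \<Rightarrow> 'c) K V. finite K \<longrightarrow> card K = m \<longrightarrow> admissible c K V \<longrightarrow> card V \<le> bound m)"

lemma boundedD:
  fixes c :: "'a \<Rightarrow> 'a \<Rightarrow> 'c"
  assumes "bounded TYPE('a \<Rightarrow> 'a \<Rightarrow> 'c) (card K)" "finite K" "admissible c K V"
  shows "card V \<le> bound (card K)"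
  using assms unfolding bounded_def by blast

text \<open>Merging \<open>r\<close> into another color of \<open>K\<close> yields an admissible
  coloring with palette \<open>K - {r}\<close>.\<close>

lemma card_matching:
  fixes c :: "'a \<Rightarrow> 'a \<Rightarrow> 'c"
  assumes "bounded TYPE('a \<Rightarrow> 'a \<Rightarrow> 'c) (card K - 1)" "finite K" "card K \<ge> 2" "r \<in> K"
    and "admissible c K W" "matching c r W"
  shows "card W \<le> bound (card K - 1)"
proof -
  obtain j where j: "j \<in> K" "j \<noteq> r"
    using two_elements[OF assms(3)] by metis
  have "card (K - {r}) = card K - 1"
    using assms(2,4) by simp
  then show ?thesis
    using boundedD[of "K - {r}" "recolor c r j" W] assms(1,2) admissible_recolor[OF assms(5,6) j]
    by simp
qed

lemma card_matching_two:
  fixes c :: "'a \<Rightarrow> 'a \<Rightarrow> 'c"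
  assumes "bounded TYPE('a \<Rightarrow> 'a \<Rightarrow> 'c) (card K - 2)" "finite K" "card K \<ge> 3"
    and rb: "r \<in> K" "b \<in> K" "r \<noteq> b"
    and "admissible c K W" "matching c r W" "matching c b W"
  shows "card W \<le> bound (card K - 2)"
proof -
  have "card (K - {r, b}) = card K - 2"
    using assms(2) rb by (simp add: card_Diff_subset)
  with assms(3) have "card (K - {r, b}) \<noteq> 0"
    by linarith
  then have "K - {r, b} \<noteq> {}"
    by (metis card.empty)
  then obtain j where j: "j \<in> K" "j \<noteq> r" "j \<noteq> b"
    by blast
  have card: "card (K - {r}) = card K - 1"
    using assms(2) rb(1) by simp
  \<comment> \<open>Since \<open>j\<close> differs from \<open>b\<close>, merging \<open>r\<close>
    into \<open>j\<close> does not change the edges of color \<open>b\<close>; hence a third color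
    is needed.\<close>
  have "matching (recolor c r j) b W"
    using assms(9) j rb unfolding matching_def recolor_def by auto
  then have "card W \<le> bound (card (K - {r}) - 1)"
    using assms(1-3) rb card j
    by (intro card_matching[OF _ _ _ _ admissible_recolor[OF assms(7,8) j(1,2)]])
      (auto simp: numeral_2_eq_2)
  then show ?thesis
    using card by (simp add: numeral_2_eq_2)
qed

section \<open>Peeling and monochromatic cuts\<close>

definition mono_cut :: "('a \<Rightarrow> 'a \<Rightarrow> 'c) \<Rightarrow> 'c \<Rightarrow> 'a set \<Rightarrow> 'a set \<Rightarrow> 'a set \<Rightarrow> bool" where
  "mono_cut c r A B C \<longleftrightarrow> A = B \<union> C \<and> B \<inter> C = {} \<and> B \<noteq> {} \<and> C \<noteq> {} \<and> (\<forall>x \<in> B. \<forall>y \<in> C. c x y = r)"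

text \<open>The vertices of \<open>T\<close> have been peeled off one by one, each one monochromatic to all the
  vertices left, and with pairwise distinct colors.\<close>

definition peeling :: "('a \<Rightarrow> 'a \<Rightarrow> 'c) \<Rightarrow> 'a set \<Rightarrow> 'a set \<Rightarrow> ('a \<Rightarrow> 'c) \<Rightarrow> 'a set \<Rightarrow> bool" where
  "peeling c V T d A \<longleftrightarrow> V = T \<union> A \<and> T \<inter> A = {} \<and> A \<noteq> {} \<and> inj_on d T \<and>
     (\<forall>t \<in> T. \<forall>a \<in> A. c t a = d t) \<and> (\<forall>s \<in> T. \<forall>t \<in> T. s \<noteq> t \<longrightarrow> c s t \<in> d ` T)"

lemma card_ge_two_or:
  assumes "finite A" "A \<noteq> {}"
  obtains x where "A = {x}" | "card A \<ge> 2"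
proof -
  have "card A \<noteq> 0" using assms by simp
  then consider "card A = 1" | "card A \<ge> 2" by linarith
  then show ?thesis
    using that by cases (auto simp: card_1_singleton_iff)
qed

text \<open>The setting of the induction step: the bounds for one and two colors fewer, and a
  peeling whose remainder \<open>A\<close> is as small as possible.\<close>

locale peeled =
  fixes c :: "'a \<Rightarrow> 'a \<Rightarrow> 'c" and K :: "'c set" and V T A :: "'a set" and d :: "'a \<Rightarrow> 'c"
  assumes adm: "admissible c K V" and K: "finite K" "card K \<ge> 3"
    and IH1: "bounded TYPE('a \<Rightarrow> 'a \<Rightarrow> 'c) (card K - 1)"
    and IH2: "bounded TYPE('a \<Rightarrow> 'a \<Rightarrow> 'c) (card K - 2)"
    and peel: "peeling c V T d A"
    and least: "\<And>T' d' A'. peeling c V T' d' A' \<Longrightarrow> card A \<le> card A'"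
begin

lemma sym: "c x y = c y x"
  using adm by (simp add: admissible_def symmetric_def)

lemma V: "V = T \<union> A" "T \<inter> A = {}" "A \<noteq> {}" "finite V" "finite A" "finite T" "A \<subseteq> V" "T \<subseteq> V"
  using peel adm by (auto simp: peeling_def admissible_def)

lemma color_in: "x \<in> V \<Longrightarrow> y \<in> V \<Longrightarrow> x \<noteq> y \<Longrightarrow> c x y \<in> K"
  using adm unfolding admissible_def colors_def by blast

lemma peel_color: "t \<in> T \<Longrightarrow> a \<in> A \<Longrightarrow> c t a = d t"
  using peel by (simp add: peeling_def)

lemma peel_color': "s \<in> T \<Longrightarrow> t \<in> T \<Longrightarrow> s \<noteq> t \<Longrightarrow> c s t \<in> d ` T"
  using peel by (simp add: peeling_def)

lemma card_T: "card T \<le> card K"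
proof (rule card_inj_on_le[of d])
  show "inj_on d T"
    using peel by (simp add: peeling_def)
  show "d ` T \<subseteq> K"
  proof
    fix i assume "i \<in> d ` T"
    then obtain t where t: "t \<in> T" "i = d t" by blast
    obtain a where a: "a \<in> A" using V(3) by blast
    have "t \<noteq> a" using t a V(2) by blast
    then show "i \<in> K"
      using color_in[of t a] t a V peel_color by auto
  qed
qed (rule K(1))

text \<open>A peeled vertex \<open>t\<close> of color \<open>r\<close> would be the hub of a wheel
  whose rim \<open>x p y q\<close> alternates between the two sides.\<close>

lemma apex:
  assumes "B \<subseteq> A" "C \<subseteq> A" "B \<inter> C = {}" "card B \<ge> 2" "card C \<ge> 2"
    and "\<And>x y. x \<in> B \<Longrightarrow> y \<in> C \<Longrightarrow> c x y = r"
  shows "r \<notin> d ` T"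
proof
  assume "r \<in> d ` T"
  then obtain t where t: "t \<in> T" "d t = r" by blast
  obtain x y where x: "x \<in> B" "y \<in> B" "x \<noteq> y" using two_elements[OF assms(4)] .
  obtain p q where p: "p \<in> C" "q \<in> C" "p \<noteq> q" using two_elements[OF assms(5)] .
  have "t \<notin> A" "x \<in> A" "y \<in> A" "p \<in> A" "q \<in> A"
    using t V assms(1,2) x p by auto
  then show False
    using t x p assms(3,6) peel_color[OF t(1)] V sym[of p y] sym[of q x]
    by (intro admissible_no_wheel[OF adm, of t x p y q r]) auto
qed

text \<open>All edges from \<open>T\<close> to \<open>A\<close> or inside \<open>T\<close> have
  colors in the image of \<open>T\<close> under \<open>d\<close>, so that no edge of color
  \<open>r\<close> meets \<open>T\<close>.\<close>

lemma matching_peeled: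
  assumes "B \<subseteq> A" "matching c r B" "r \<notin> d ` T"
  shows "matching c r (B \<union> T)"
proof -
  have "x \<in> B \<and> y \<in> B" if "x \<in> B \<union> T" "y \<in> B \<union> T" "x \<noteq> y" "c x y = r" for x y
    using that assms(1,3) peel_color peel_color' sym[of x y] by (metis UnE image_eqI subsetD)
  then show ?thesis
    using assms(2) unfolding matching_def by blast
qed

lemma card_matching1: "W \<subseteq> V \<Longrightarrow> r \<in> K \<Longrightarrow> matching c r W \<Longrightarrow> card W \<le> bound (card K - 1)"
  by (rule card_matching[OF IH1 K(1) _ _ admissible_subset[OF adm]]) (use K(2) in auto)

lemma card_matching2:
  "W \<subseteq> V \<Longrightarrow> r \<in> K \<Longrightarrow> b \<in> K \<Longrightarrow> r \<noteq> b \<Longrightarrow> matching c r W \<Longrightarrow> matching c b W \<Longrightarrow>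
    card W \<le> bound (card K - 2)"
  by (rule card_matching_two[OF IH2 K _ _ _ admissible_subset[OF adm]])

lemma cut_color: "mono_cut c r A B C \<Longrightarrow> r \<in> K"
  using color_in V unfolding mono_cut_def by (metis IntI Un_iff ex_in_conv)

lemma card_V: "card V = card T + card A"
  using V by (simp add: card_Un_disjoint)

text \<open>By minimality \<open>a\<close> cannot be peeled off, so its color \<open>r\<close>
  already belongs to some \<open>t\<close> in \<open>T\<close>. Then \<open>t\<close> and
  \<open>a\<close> are two vertices joined to all of \<open>C\<close> in color \<open>r\<close>,
  which makes \<open>r\<close> a matching on \<open>C\<close>.\<close>

lemma bound_singleton_cut:
  assumes cut: "mono_cut c r A {a} C"
  shows "card V \<le> bound (card K)"
proof -
  have A: "A = insert a C" "a \<notin> C" "C \<noteq> {}" and r: "\<And>y. y \<in> C \<Longrightarrow> c a y = r"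
    using cut by (auto simp: mono_cut_def)
  have aT: "a \<notin> T" using A V by blast
  have "r \<in> d ` T"
  proof (rule ccontr)
    assume nr: "r \<notin> d ` T"
    have "peeling c V (insert a T) (d(a := r)) C"
      unfolding peeling_def
    proof (intro conjI ballI impI)
      show "inj_on (d(a := r)) (insert a T)"
        using peel nr aT by (auto simp: peeling_def inj_on_def)
      show "c t x = (d(a := r)) t" if "t \<in> insert a T" "x \<in> C" for t x
        using that r peel_color A aT by auto
      show "c s t \<in> (d(a := r)) ` insert a T" if "s \<in> insert a T" "t \<in> insert a T" "s \<noteq> t" for s t
      proof -
        have "d ` T \<subseteq> (d(a := r)) ` insert a T"
          using aT by (auto simp: image_iff)
        moreover have "c s t \<in> d ` T"
          using that peel_color[of s t] peel_color[of t s] peel_color'[of s t] A sym[of s t]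
          by (auto simp: image_iff)
        ultimately show ?thesis by blast
      qed
    qed (use V A aT in auto)
    then have "card A \<le> card C"
      by (rule least)
    then show False
      using A V(5) by simp
  qed
  then obtain t where t: "t \<in> T" "d t = r" by blast
  have "t \<noteq> a" using t aT by blast
  have tc: "c x y = r" if "x \<in> C" "y \<in> {t, a}" for x y
    using that t A r[of x] peel_color[OF t(1), of x] sym[of x y] by auto
  have "matching c r C"
    by (rule matching_of_cut[OF adm, of C "{t, a}"])
      (use t A V \<open>t \<noteq> a\<close> tc in auto)
  then have "card C \<le> bound (card K - 1)"
    using card_matching1[OF _ cut_color[OF cut]] A V by blast
  moreover have "card A = Suc (card C)"
    using A V(5) by simp
  ultimately show ?thesis
    using card_V card_T bound_step(3)[OF K(2)] by linarith
qed

text \<open>The color \<open>r\<close> forms a matching on both sides and is not a color of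
  \<open>T\<close>, so \<open>T\<close> can be counted with \<open>B\<close>; each of the two parts
  has at most \<open>bound (card K - 1)\<close> vertices.\<close>

lemma bound_large_cut:
  assumes cut: "mono_cut c r A B C" and "card B \<ge> 2" "card C \<ge> 2"
  shows "card V \<le> bound (card K)"
proof -
  have A: "A = B \<union> C" "B \<inter> C = {}" and r: "\<And>x y. x \<in> B \<Longrightarrow> y \<in> C \<Longrightarrow> c x y = r"
    using cut by (auto simp: mono_cut_def)
  have r': "c y x = r" if "x \<in> B" "y \<in> C" for x y
    using r[OF that] sym[of x y] by simp
  have sub: "B \<subseteq> A" "C \<subseteq> A" "B \<subseteq> V" "C \<subseteq> V" using A V by auto
  have "r \<notin> d ` T"
    using apex[OF sub(1,2) A(2) assms(2,3) r] .
  then have "matching c r (B \<union> T)"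
    using matching_of_cut[OF adm sub(3,4) A(2) assms(3) r] matching_peeled[OF sub(1)] by blast
  moreover have "matching c r C"
    by (rule matching_of_cut[OF adm sub(4,3) _ assms(2)]) (use A r' in auto)
  ultimately have "card (B \<union> T) \<le> bound (card K - 1)" "card C \<le> bound (card K - 1)"
    using card_matching1[OF _ cut_color[OF cut]] sub V by auto
  moreover have "V = (B \<union> T) \<union> C"
    using V A by blast
  then have "card V \<le> card (B \<union> T) + card C"
    by (metis card_Un_le)
  ultimately show ?thesis
    using bound_step(1)[OF K(2)] by linarith
qed

lemma bound_mono_cut:
  assumes cut: "mono_cut c r A B C"
  shows "card V \<le> bound (card K)"
proof -
  have fin: "finite B" "finite C" "B \<noteq> {}" "C \<noteq> {}"
    using cut V(5) by (auto simp: mono_cut_def)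
  have cut': "mono_cut c r A C B"
    using cut sym unfolding mono_cut_def by (metis Int_commute Un_commute)
  show ?thesis
  proof (cases rule: card_ge_two_or[OF fin(1,3)])
    case (1 x)
    then show ?thesis using bound_singleton_cut cut by blast
  next
    case B: 2
    show ?thesis
    proof (cases rule: card_ge_two_or[OF fin(2,4)])
      case (1 x)
      then show ?thesis using bound_singleton_cut cut' by blast
    next
      case 2
      then show ?thesis using bound_large_cut[OF cut B] by blast
    qed
  qed
qed

end

lemma bound_ge_14: "k \<ge> 2 \<Longrightarrow> bound k \<ge> 14"
  by (auto simp: bound_def)

lemma bounded_one: "bounded TYPE('a \<Rightarrow> 'a \<Rightarrow> 'c) 1"
  unfolding bounded_def using card_one_color by auto

section \<open>Gallai partitions without monochromatic cuts\<close>

context peeled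
begin

definition two_colored :: "('a \<Rightarrow> 'a \<Rightarrow> bool) \<Rightarrow> 'c \<Rightarrow> 'c \<Rightarrow> bool" where
  "two_colored E r b \<longleftrightarrow> equivp E \<and> r \<noteq> b \<and> (\<exists>x \<in> A. \<exists>y \<in> A. \<not> E x y) \<and>
     (\<forall>x \<in> A. \<forall>y \<in> A. \<forall>z \<in> A. E x y \<longrightarrow> \<not> E x z \<longrightarrow> c x z = c y z) \<and>
     (\<forall>x \<in> A. \<forall>y \<in> A. \<not> E x y \<longrightarrow> c x y \<in> {r, b})"

definition cls :: "('a \<Rightarrow> 'a \<Rightarrow> bool) \<Rightarrow> 'a \<Rightarrow> 'a set" where
  "cls E x = {y \<in> A. E x y}"

text \<open>For a Gallai partition these vertices are joined in color \<open>r\<close> to the whole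
  class of \<open>x\<close>, as \<open>cls_nb\<close> shows.\<close>

definition nb :: "('a \<Rightarrow> 'a \<Rightarrow> bool) \<Rightarrow> 'c \<Rightarrow> 'a \<Rightarrow> 'a set" where
  "nb E r x = {y \<in> A. \<not> E x y \<and> c x y = r}"

lemma two_colored_swap: "two_colored E r b \<Longrightarrow> two_colored E b r"
  unfolding two_colored_def by blast

lemma cls_sub: "cls E x \<subseteq> A" "cls E x \<subseteq> V" "nb E r x \<subseteq> A" "nb E r x \<subseteq> V"
  "finite (cls E x)" "finite (nb E r x)" "cls E x \<inter> nb E r x = {}" "nb E r x \<inter> cls E x = {}"
  using V by (auto simp: cls_def nb_def)

lemma cls_nb: "two_colored E r b \<Longrightarrow> x \<in> A \<Longrightarrow> y \<in> cls E x \<Longrightarrow> z \<in> nb E i x \<Longrightarrow> c y z = i"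
  unfolding two_colored_def cls_def nb_def by force

lemma nb_cls: "two_colored E r b \<Longrightarrow> x \<in> A \<Longrightarrow> y \<in> nb E i x \<Longrightarrow> z \<in> cls E x \<Longrightarrow> c y z = i"
  using cls_nb sym by metis

lemma self_cls: "two_colored E r b \<Longrightarrow> x \<in> A \<Longrightarrow> x \<in> cls E x"
  by (auto simp: two_colored_def cls_def equivp_reflp)

lemma cover: "two_colored E r b \<Longrightarrow> x \<in> A \<Longrightarrow> A = cls E x \<union> nb E r x \<union> nb E b x"
  unfolding two_colored_def cls_def nb_def by blast

lemma nb_disjoint: "r \<noteq> b \<Longrightarrow> nb E r x \<inter> nb E b x = {}"
  by (auto simp: nb_def)

text \<open>Without neighbors in color \<open>r\<close>, the class of \<open>x\<close> would be
  joined to the rest of \<open>A\<close> in color \<open>b\<close> only, a monochromatic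
  cut.\<close>

lemma nb_nonempty:
  assumes E: "two_colored E r b" "x \<in> A" and nocut: "\<And>i B C. \<not> mono_cut c i A B C"
  shows "nb E r x \<noteq> {}"
proof
  assume "nb E r x = {}"
  then have A: "A = cls E x \<union> nb E b x"
    using cover[OF E] by simp
  have "nb E b x \<noteq> {}"
  proof
    assume "nb E b x = {}"
    then have "\<forall>y \<in> A. E x y"
      using A by (auto simp: cls_def)
    then show False
      using E(1) unfolding two_colored_def by (meson equivp_symp equivp_transp)
  qed
  then have "mono_cut c b A (cls E x) (nb E b x)"
    using A cls_sub(7) self_cls[OF E] cls_nb[OF E] unfolding mono_cut_def by blast
  then show False
    using nocut by blast
qed

lemma cls_matching:
  assumes "two_colored E r b" "x \<in> A" "card (cls E x) \<ge> 2" "card (nb E i x) \<ge> 2"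
  shows "matching c i (cls E x)" "i \<notin> d ` T"
  using matching_of_cut[OF adm cls_sub(2,4,7) assms(4) cls_nb[OF assms(1,2)]]
    apex[OF cls_sub(1,3,7) assms(3,4) cls_nb[OF assms(1,2)]] by auto

lemma nb_matching:
  assumes "two_colored E r b" "x \<in> A" "card (cls E x) \<ge> 2"
  shows "matching c i (nb E i x)"
  using matching_of_cut[OF adm cls_sub(4,2,8) assms(3) nb_cls[OF assms(1,2)]] .

lemma color_nb:
  assumes "two_colored E r b" "x \<in> A" "nb E i x \<noteq> {}"
  shows "i \<in> K"
proof -
  obtain y where y: "y \<in> nb E i x"
    using assms(3) by blast
  have "x \<noteq> y"
    using y self_cls[OF assms(1,2)] cls_sub(7)[of E x i] by blast
  then have "c x y \<in> K"
    using y assms(2) cls_sub(4) V by (intro color_in) auto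
  then show ?thesis
    using y by (simp add: nb_def)
qed

text \<open>The blue neighborhood \<open>?Y\<close> turns out to have at least two vertices, so blue
  forms a matching on the class. The vertex \<open>u\<close> is attached to the class in red, hence
  \<open>V\<close> splits into two parts on which blue is a matching: the class with
  \<open>u\<close>, and \<open>?Y\<close> with \<open>T\<close>.\<close>

lemma bound_single_neighbor:
  assumes E: "two_colored E r b" "x \<in> A" "card (cls E x) \<ge> 2" and u: "nb E r x = {u}"
    and nocut: "\<And>i B C. \<not> mono_cut c i A B C"
  shows "card V \<le> bound (card K)"
proof -
  let ?P = "cls E x" and ?Y = "nb E b x"
  have rb: "r \<noteq> b" using E(1) by (simp add: two_colored_def)
  have Y: "?Y \<noteq> {}"
    using nb_nonempty[OF two_colored_swap[OF E(1)] E(2) nocut] .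
  have A: "A = insert u ?P \<union> ?Y" "u \<in> A" "u \<notin> ?P" "u \<notin> ?Y"
    using cover[OF E(1,2)] u cls_sub(7)[of E x r] nb_disjoint[OF rb, of E x] by auto
  have Pu: "c y u = r" if "y \<in> ?P" for y
    using cls_nb[OF E(1,2) that, of u r] u by simp
  have "card ?Y \<ge> 2"
  proof (rule card_ge_two_or[OF cls_sub(6) Y])
    fix w assume w: "?Y = {w}"
    have "w \<in> A" "w \<noteq> u" "w \<notin> ?P"
      using w A cls_sub(3)[of E b x] cls_sub(7)[of E x b] by auto
    have Pw: "c y w = b" if "y \<in> ?P" for y
      using cls_nb[OF E(1,2) that, of w b] w by simp
    have "\<not> E u w"
    proof
      assume "E u w"
      moreover have "\<not> E u x"
        using u E(1) unfolding nb_def two_colored_def by (metis (mono_tags, lifting) equivp_symp mem_Collect_eq singletonI)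
      ultimately have "c u x = c w x"
        using E A \<open>w \<in> A\<close> unfolding two_colored_def by blast
      then show False
        using Pu Pw self_cls[OF E(1,2)] rb sym by metis
    qed
    \<comment> \<open>If \<open>?Y\<close> were a single vertex \<open>w\<close>, the color of
      \<open>u w\<close> would separate either \<open>u\<close> or \<open>w\<close> from the rest of
      \<open>A\<close> by a monochromatic cut.\<close>
    then have "c u w \<in> {r, b}"
      using E(1) A \<open>w \<in> A\<close> unfolding two_colored_def by blast
    moreover have "mono_cut c r A (insert w ?P) {u}" if "c u w = r"
      using that A w Pu sym[of u w] \<open>w \<noteq> u\<close> by (auto simp: mono_cut_def)
    moreover have "mono_cut c b A (insert u ?P) {w}" if "c u w = b"
      using that A w Pw \<open>w \<noteq> u\<close> \<open>w \<notin> ?P\<close> by (auto simp: mono_cut_def)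
    ultimately show ?thesis
      using nocut by blast
  qed
  note m = cls_matching[OF E this]
  have "matching c b (insert u ?P)"
    using m(1) Pu rb sym unfolding matching_def by (metis insert_iff)
  moreover have "matching c b (?Y \<union> T)"
    using matching_peeled[OF cls_sub(3) nb_matching[OF E] m(2)] .
  moreover have "insert u ?P \<subseteq> V" "?Y \<union> T \<subseteq> V"
    using A V cls_sub(2)[of E x] cls_sub(4)[of E b x] by auto
  ultimately have "card (insert u ?P) \<le> bound (card K - 1)" "card (?Y \<union> T) \<le> bound (card K - 1)"
    using card_matching1 color_nb[OF E(1,2) Y] by blast+
  moreover have "V = insert u ?P \<union> (?Y \<union> T)"
    using V(1) A(1) by blast
  then have "card V \<le> card (insert u ?P) + card (?Y \<union> T)"
    by (metis card_Un_le)
  ultimately show ?thesis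
    using bound_step(1)[OF K(2)] by linarith
qed

text \<open>Red is a matching on the red neighborhood \<open>?X\<close>. If \<open>?X\<close>
  contains a class \<open>?B\<close> with at least two vertices, both red and blue are matchings on
  \<open>?B\<close> and on \<open>?X - ?B\<close>. If all classes in \<open>?X\<close> are
  singletons, only red and blue occur there.\<close>

lemma card_nb:
  assumes E: "two_colored E r b" "x \<in> A" "card (cls E x) \<ge> 2"
    and large: "\<And>y i. y \<in> A \<Longrightarrow> card (cls E y) \<ge> 2 \<Longrightarrow> i \<in> {r, b} \<Longrightarrow> card (nb E i y) \<ge> 2"
  shows "card (nb E r x) \<le> 2 * bound (card K - 2)"
proof -
  let ?X = "nb E r x"
  have rb: "r \<noteq> b" using E(1) by (simp add: two_colored_def)
  have "nb E r x \<noteq> {}" "nb E b x \<noteq> {}"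
    using large[OF E(2,3), of r] large[OF E(2,3), of b] by auto
  then have rbK: "r \<in> K" "b \<in> K"
    using color_nb[OF E(1,2)] by auto
  have mX: "matching c r ?X"
    using nb_matching[OF E] .
  show ?thesis
  proof (cases "\<exists>z \<in> ?X. card (cls E z) \<ge> 2")
    case True
    then obtain z where z: "z \<in> ?X" "card (cls E z) \<ge> 2" by blast
    let ?B = "cls E z"
    have zA: "z \<in> A" using z cls_sub by blast
    have B: "?B \<subseteq> ?X"
    proof
      fix y assume "y \<in> ?B"
      then have y: "y \<in> A" "E z y" by (auto simp: cls_def)
      have eq: "equivp E" using E(1) by (simp add: two_colored_def)
      have nz: "\<not> E x z" "c x z = r" using z by (auto simp: nb_def)
      have "\<not> E z x" "\<not> E x y"
        using nz y eq by (meson equivp_symp equivp_transp)+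
      moreover have "c z x = c y x"
        using E(1,2) zA y calculation unfolding two_colored_def by blast
      ultimately show "y \<in> ?X"
        using y nz sym by (auto simp: nb_def)
    qed
    \<comment> \<open>If \<open>u\<close> were joined to \<open>?B\<close> in red, two vertices of
      \<open>?B\<close> and \<open>u\<close> would form a red path inside \<open>?X\<close>.\<close>
    have D: "c y u = b" if "u \<in> ?X - ?B" "y \<in> ?B" for u y
    proof -
      have u: "u \<in> A" "\<not> E z u"
        using that(1) cls_sub(3) by (auto simp: cls_def)
      then have "u \<in> nb E r z \<or> u \<in> nb E b z"
        using cover[OF E(1) zA] by (auto simp: cls_def)
      moreover have "u \<notin> nb E r z"
      proof
        assume ur: "u \<in> nb E r z"
        obtain p q where pq: "p \<in> ?B" "q \<in> ?B" "p \<noteq> q"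
          using two_elements[OF z(2)] .
        have "c p u = r" "c u q = r"
          using cls_nb[OF E(1) zA _ ur] nb_cls[OF E(1) zA ur] pq by auto
        moreover have "p \<in> ?X" "u \<in> ?X" "q \<in> ?X" "p \<noteq> u" "u \<noteq> q"
          using pq B that(1) by auto
        ultimately show False
          using mX pq(3) unfolding matching_def by blast
      qed
      ultimately show ?thesis
        using cls_nb[OF E(1) zA that(2)] by blast
    qed
    have XV: "?X - ?B \<subseteq> V" "(?X - ?B) \<inter> ?B = {}"
      using cls_sub(4) by auto
    have "matching c b (?X - ?B)"
    proof (rule matching_of_cut[OF adm XV(1) cls_sub(2) XV(2) z(2)])
      show "c u y = b" if "u \<in> ?X - ?B" "y \<in> ?B" for u y
        using D[OF that] sym by simp
    qed
    moreover have "matching c b ?B"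
      using cls_matching(1)[OF E(1) zA z(2)] large[OF zA z(2)] by blast
    moreover have "matching c r (?X - ?B)" "matching c r ?B"
      using matching_subset[OF mX] B by auto
    ultimately have "card (?X - ?B) \<le> bound (card K - 2)" "card ?B \<le> bound (card K - 2)"
      using card_matching2 rbK rb XV(1) cls_sub(2) by auto
    moreover have "card ?X = card ?B + card (?X - ?B)"
      using B cls_sub(5,6) by (metis card_Diff_subset card_mono le_add_diff_inverse)
    ultimately show ?thesis by simp
  next
    case False
    have "\<not> E u w" if "u \<in> ?X" "w \<in> ?X" "u \<noteq> w" for u w
    proof
      assume "E u w"
      then have "{u, w} \<subseteq> cls E u"
        using that cls_sub(3) self_cls[OF E(1), of u] by (auto simp: cls_def)
      then have "card (cls E u) \<ge> 2"
        using card_mono[OF cls_sub(5), of "{u, w}" E u] that(3) by simp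
      then show False using False that(1) by blast
    qed
    then have "colors c ?X \<subseteq> {r, b}"
      using E(1) cls_sub(3)[of E r x] unfolding two_colored_def colors_def by blast
    then have "admissible c {r, b} ?X"
      using admissible_subset[OF adm cls_sub(4), of E r x] by (simp add: admissible_def)
    \<comment> \<open>Merging red into blue leaves a single color, hence at most four
      vertices.\<close>
    then have "card ?X \<le> bound (card {r, b} - 1)"
      by (rule card_matching[rotated -2]) (use rb mX bounded_one in auto)
    then have "card ?X \<le> 4"
      using rb by simp
    moreover have "bound (card K - 2) \<ge> card K - 2 + 3"
      using K(2) by (intro bound_ge) auto
    ultimately show ?thesis by simp
  qed
qed

theorem bound_peeled: "card V \<le> bound (card K)"
proof (cases rule: card_ge_two_or[OF V(5,3)])
  case (1 x)
  then show ?thesis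
    using card_V card_T bound_ge[of "card K"] K(2) by simp
next
  case 2
  show ?thesis
  proof (cases "\<exists>i B C. mono_cut c i A B C")
    case True
    then show ?thesis using bound_mono_cut by blast
  next
    case False
    then have nocut: "\<And>i B C. \<not> mono_cut c i A B C" by blast
    have "symmetric c" "gallai c A"
      using adm gallai_subset V(7) by (auto simp: admissible_def)
    then obtain E r b where eq: "equivp E" and ne: "\<exists>x \<in> A. \<exists>y \<in> A. \<not> E x y"
      and hom: "\<And>x y z. x \<in> A \<Longrightarrow> z \<in> A \<Longrightarrow> E x y \<Longrightarrow> \<not> E x z \<Longrightarrow> c x z = c y z"
      and col: "\<And>x y. x \<in> A \<Longrightarrow> y \<in> A \<Longrightarrow> \<not> E x y \<Longrightarrow> c x y \<in> {r, b}"
      by (rule gallai_partition[OF V(5) 2]) blast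
    \<comment> \<open>With one color between the classes, any class and its complement in
      \<open>A\<close> would form a monochromatic cut.\<close>
    have rb: "r \<noteq> b"
    proof
      assume "r = b"
      obtain x y where xy: "x \<in> A" "y \<in> A" "\<not> E x y"
        using ne by blast
      have "c u w = r" if "u \<in> cls E x" "w \<in> A - cls E x" for u w
      proof -
        have "\<not> E u w"
          using that eq unfolding cls_def by (metis (mono_tags, lifting) DiffE equivp_transp mem_Collect_eq)
        then show ?thesis
          using col[of u w] that \<open>r = b\<close> cls_sub(1) by auto
      qed
      then have "mono_cut c r A (cls E x) (A - cls E x)"
        using xy equivp_reflp[OF eq] cls_sub(1)[of E x] unfolding mono_cut_def cls_def by blast
      then show False
        using nocut by blast
    qed
    have E: "two_colored E r b"
      unfolding two_colored_def using eq rb ne hom col by blast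
    show ?thesis
    proof (cases "\<exists>x \<in> A. card (cls E x) \<ge> 2")
      case False
      have "\<not> E u w" if "u \<in> A" "w \<in> A" "u \<noteq> w" for u w
      proof
        assume "E u w"
        then have "{u, w} \<subseteq> cls E u"
          using that self_cls[OF E, of u] by (auto simp: cls_def)
        then have "card (cls E u) \<ge> 2"
          using card_mono[OF cls_sub(5), of "{u, w}" E u] that(3) by simp
        then show False using False that(1) by blast
      qed
      then have "colors c A \<subseteq> {r, b}"
        using col unfolding colors_def by blast
      then have "admissible c {r, b} A"
        using admissible_subset[OF adm V(7)] by (simp add: admissible_def)
      then have "card A \<le> 14"
        by (rule card_two_colors[of c _ A r b]) simp
      moreover have "bound (card K - 1) \<ge> 14"
        using K(2) by (intro bound_ge_14) auto
      ultimately show ?thesis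
        using card_V card_T bound_step(3)[OF K(2)] by linarith
    next
      case True
      then obtain x where x: "x \<in> A" "card (cls E x) \<ge> 2" by blast
      show ?thesis
      proof (cases "\<exists>y \<in> A. card (cls E y) \<ge> 2 \<and> (\<exists>i \<in> {r, b}. \<exists>u. nb E i y = {u})")
        case True
        then show ?thesis
          using bound_single_neighbor[OF E _ _ _ nocut]
            bound_single_neighbor[OF two_colored_swap[OF E] _ _ _ nocut] by blast
      next
        case False
        \<comment> \<open>Neighborhoods of large classes are nonempty because there is no cut, and
          not singletons by the case assumption.\<close>
        have large: "card (nb E i y) \<ge> 2" if y: "y \<in> A" "card (cls E y) \<ge> 2" "i \<in> {r, b}" for y i
        proof -
          have "nb E i y \<noteq> {}"
            using y nb_nonempty[OF E y(1) nocut] nb_nonempty[OF two_colored_swap[OF E] y(1) nocut]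
            by auto
          then show ?thesis
            by (rule card_ge_two_or[OF cls_sub(6)]) (use False y in blast)+
        qed
        \<comment> \<open>Neither \<open>r\<close> nor \<open>b\<close> is the color of a peeled
          vertex, so \<open>T\<close> is counted together with the class of
          \<open>x\<close>.\<close>
        have m: "matching c i (cls E x \<union> T)" if "i \<in> {r, b}" for i
          using cls_matching[OF E x large[OF x that]] matching_peeled[OF cls_sub(1)] by blast
        have "nb E r x \<noteq> {}" "nb E b x \<noteq> {}"
          using large[OF x, of r] large[OF x, of b] by auto
        then have "card (cls E x \<union> T) \<le> bound (card K - 2)"
          using color_nb[OF E x(1)] rb m cls_sub(2)[of E x] V(8)
          by (intro card_matching2[of _ r b]) auto
        moreover have "card (nb E r x) \<le> 2 * bound (card K - 2)"
          using card_nb[OF E x large] .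
        moreover have "card (nb E b x) \<le> 2 * bound (card K - 2)"
          by (rule card_nb[OF two_colored_swap[OF E] x large]) auto
        moreover have "card V = card ((cls E x \<union> T) \<union> (nb E r x \<union> nb E b x))"
          using cover[OF E x(1)] V(1) by (intro arg_cong[of _ _ card]) blast
        then have "card V \<le> card (cls E x \<union> T) + (card (nb E r x) + card (nb E b x))"
          using card_Un_le[of "cls E x \<union> T" "nb E r x \<union> nb E b x"]
            card_Un_le[of "nb E r x" "nb E b x"] by linarith
        ultimately show ?thesis
          using bound_step(2)[OF K(2)] by linarith
      qed
    qed
  qed
qed

end

theorem card_admissible:
  fixes c :: "'a \<Rightarrow> 'a \<Rightarrow> 'c"
  assumes "k \<ge> 1"
  shows "bounded TYPE('a \<Rightarrow> 'a \<Rightarrow> 'c) k"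
  using assms
proof (induction k rule: less_induct)
  case (less k)
  consider "k = 1" | "k = 2" | "k \<ge> 3"
    using less.prems by linarith
  then show ?case
  proof cases
    case 1
    then show ?thesis using bounded_one by simp
  next
    case 2
    then show ?thesis
      unfolding bounded_def using card_two_colors[OF _ order_refl] by (auto simp: card_2_iff)
  next
    case 3
    show ?thesis
      unfolding bounded_def
    proof (intro allI impI)
      fix c :: "'a \<Rightarrow> 'a \<Rightarrow> 'c" and K V
      assume K: "finite K" "card K = k" and adm: "admissible c K V"
      show "card V \<le> bound k"
      proof (cases "V = {}")
        case False
        let ?P = "\<lambda>n. \<exists>T d A. peeling c V T d A \<and> card A = n"
        \<comment> \<open>Peeling off nothing is always possible, so a peeling with least remainder
          exists; the values of \<open>d\<close> on the empty set do not matter.\<close>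
        have "peeling c V {} (\<lambda>_. undefined) V"
          using False by (simp add: peeling_def)
        then have "?P (card V)" by blast
        then obtain n where n: "?P n" "\<And>m. ?P m \<Longrightarrow> n \<le> m"
          using ex_least_nat_le[of ?P] by (metis le_cases not_le_imp_less)
        then obtain T d A where A: "peeling c V T d A" "card A = n" by blast
        have "peeled c K V T A d"
        proof
          show "card A \<le> card A'" if "peeling c V T' d' A'" for T' d' A'
            using n(2)[of "card A'"] that A(2) by blast
          show "bounded TYPE('a \<Rightarrow> 'a \<Rightarrow> 'c) (card K - 1)" "bounded TYPE('a \<Rightarrow> 'a \<Rightarrow> 'c) (card K - 2)"
            using less.IH K(2) 3 by auto
        qed (use K adm 3 A in auto)
        then show ?thesis
          using peeled.bound_peeled K(2) by blast
      qed simp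
    qed
  qed
qed

section \<open>The lower bound\<close>

definition triangle_free :: "('a \<Rightarrow> 'a \<Rightarrow> 'c) \<Rightarrow> 'a set \<Rightarrow> bool" where
  "triangle_free g W \<longleftrightarrow> (\<forall>x \<in> W. \<forall>y \<in> W. \<forall>z \<in> W. x \<noteq> y \<longrightarrow> y \<noteq> z \<longrightarrow> x \<noteq> z \<longrightarrow>
     \<not> (g x y = g x z \<and> g y z = g x z))"

definition blow_up :: "('a \<Rightarrow> 'a \<Rightarrow> 'c) \<Rightarrow> ('b \<Rightarrow> 'b \<Rightarrow> 'c) \<Rightarrow> 'b \<times> 'a \<Rightarrow> 'b \<times> 'a \<Rightarrow> 'c" where
  "blow_up c g u w = (if fst u = fst w then c (snd u) (snd w) else g (fst u) (fst w))"

text \<open>Colors in \<open>K\<close> live inside the copies of \<open>V\<close>, colors in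
  \<open>L\<close> between them. A wheel with a color in \<open>K\<close> lies in one copy, as every
  rim vertex is joined to the hub; with a color in \<open>L\<close>, the hub and two consecutive rim
  vertices would project to a monochromatic triangle of \<open>g\<close>.\<close>

lemma admissible_blow_up:
  assumes c: "admissible c K V" and W: "finite W" "symmetric g" "gallai g W" "triangle_free g W"
    and L: "colors g W \<subseteq> L" "K \<inter> L = {}"
  shows "admissible (blow_up c g) (K \<union> L) (W \<times> V)"
proof -
  have cV: "finite V" "symmetric c" "gallai c V" "colors c V \<subseteq> K"
    using c by (auto simp: admissible_def)
  have symo: "g x y = g y x" for x y
    using W(2) by (simp add: symmetric_def)
  have inner: "c x y \<in> K" if "x \<in> V" "y \<in> V" "x \<noteq> y" for x y
    using cV(4) that unfolding colors_def by blast
  have outer: "g x y \<in> L" if "x \<in> W" "y \<in> W" "x \<noteq> y" for x y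
    using L(1) that unfolding colors_def by blast
  have no_triangle: "\<not> (g x y = g x z \<and> g y z = g x z)"
    if "x \<in> W" "y \<in> W" "z \<in> W" "x \<noteq> y" "y \<noteq> z" "x \<noteq> z" for x y z
    using W(4) that unfolding triangle_free_def by auto
  have "symmetric (blow_up c g)"
    using cV(2) W(2) by (auto simp: symmetric_def blow_up_def)
  moreover have "gallai (blow_up c g) (W \<times> V)"
    unfolding gallai_def
  proof (intro ballI impI)
    fix x y z
    assume xyz: "x \<in> W \<times> V" "y \<in> W \<times> V" "z \<in> W \<times> V" "x \<noteq> y" "y \<noteq> z" "x \<noteq> z"
    then have mem: "fst x \<in> W" "fst y \<in> W" "fst z \<in> W" "snd x \<in> V" "snd y \<in> V" "snd z \<in> V"
      by auto
    consider "fst x = fst y" "fst y = fst z" | "fst x = fst y" "fst y \<noteq> fst z"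
      | "fst x \<noteq> fst y" "fst y = fst z" | "fst x = fst z" "fst x \<noteq> fst y"
      | "fst x \<noteq> fst y" "fst y \<noteq> fst z" "fst x \<noteq> fst z"
      by metis
    then show "blow_up c g x y = blow_up c g y z \<or> blow_up c g y z = blow_up c g x z \<or>
        blow_up c g x y = blow_up c g x z"
    proof cases
      case 1
      then have "snd x \<noteq> snd y" "snd y \<noteq> snd z" "snd x \<noteq> snd z"
        using xyz by (auto simp: prod_eq_iff)
      then show ?thesis
        using 1 cV(3) mem unfolding gallai_def blow_up_def by simp
    next
      case 5
      then show ?thesis
        using W(3) mem unfolding gallai_def blow_up_def by simp
    qed (auto simp: blow_up_def symo)
  qed
  moreover have "colors (blow_up c g) (W \<times> V) \<subseteq> K \<union> L"
    using inner outer by (auto simp: colors_def blow_up_def)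
  moreover have "\<not> wheel (same (blow_up c g) i) (W \<times> V)" for i
  proof
    assume "wheel (same (blow_up c g) i) (W \<times> V)"
    then obtain h p q s t where V: "{h, p, q, s, t} \<subseteq> W \<times> V" "distinct [h, p, q, s, t]"
      and i: "blow_up c g h p = i" "blow_up c g h q = i" "blow_up c g h s = i"
        "blow_up c g h t = i" "blow_up c g p q = i" "blow_up c g q s = i"
        "blow_up c g s t = i" "blow_up c g t p = i"
      unfolding wheel_def same_def by blast
    have mem: "fst x \<in> W" "snd x \<in> V" if "x \<in> {h, p, q, s, t}" for x
      using that V(1) by auto
    have fibre: "fst x = fst y \<longleftrightarrow> i \<in> K"
      if "x \<in> {h, p, q, s, t}" "y \<in> {h, p, q, s, t}" "x \<noteq> y" "blow_up c g x y = i" for x y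
      using inner[OF mem(2)[OF that(1)] mem(2)[OF that(2)]]
        outer[OF mem(1)[OF that(1)] mem(1)[OF that(2)]] that(3,4) L(2)
      unfolding blow_up_def by (auto simp: prod_eq_iff split: if_splits)
    have f: "fst h = fst p \<longleftrightarrow> i \<in> K" "fst h = fst q \<longleftrightarrow> i \<in> K" "fst h = fst s \<longleftrightarrow> i \<in> K"
      "fst h = fst t \<longleftrightarrow> i \<in> K" "fst p = fst q \<longleftrightarrow> i \<in> K"
      using fibre[of h p] fibre[of h q] fibre[of h s] fibre[of h t] fibre[of p q] V(2) i by auto
    show False
    proof (cases "i \<in> K")
      case True
      then have e: "fst p = fst h" "fst q = fst h" "fst s = fst h" "fst t = fst h"
        using f by auto
      then have "distinct [snd h, snd p, snd q, snd s, snd t]"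
        using V(2) by (auto simp: prod_eq_iff)
      moreover have "{snd h, snd p, snd q, snd s, snd t} \<subseteq> V"
        using mem(2) by blast
      ultimately show False
        using admissible_no_wheel[OF c, of "snd h" "snd p" "snd q" "snd s" "snd t" i] i e
        by (simp add: blow_up_def)
    next
      case False
      then have "fst h \<noteq> fst p" "fst h \<noteq> fst q" "fst p \<noteq> fst q"
        using f by auto
      moreover from this have "g (fst h) (fst p) = i" "g (fst h) (fst q) = i" "g (fst p) (fst q) = i"
        using i by (auto simp: blow_up_def)
      ultimately show False
        using no_triangle[of "fst h" "fst p" "fst q"] mem(1)[of h] mem(1)[of p] mem(1)[of q] by simp
    qed
  qed
  ultimately show ?thesis
    using cV(1) W(1) by (simp add: admissible_def)
qed

lemma admissible_pullback:
  assumes c: "admissible c K V" and f: "finite U" "inj_on f U" "f ` U \<subseteq> V"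
  shows "admissible (\<lambda>x y. c (f x) (f y)) K U"
proof -
  let ?c = "\<lambda>x y. c (f x) (f y)"
  have cV: "symmetric c" "gallai c V" "colors c V \<subseteq> K"
    using c by (auto simp: admissible_def)
  have ne: "f x \<noteq> f y" if "x \<in> U" "y \<in> U" "x \<noteq> y" for x y
    using f(2) that by (auto dest: inj_onD)
  have "symmetric ?c"
    using cV(1) by (simp add: symmetric_def)
  moreover have "gallai ?c U"
    unfolding gallai_def
  proof (intro ballI impI)
    fix x y z assume "x \<in> U" "y \<in> U" "z \<in> U" "x \<noteq> y" "y \<noteq> z" "x \<noteq> z"
    then have "f x \<in> V" "f y \<in> V" "f z \<in> V" "f x \<noteq> f y" "f y \<noteq> f z" "f x \<noteq> f z"
      using ne f(3) by auto
    then show "?c x y = ?c y z \<or> ?c y z = ?c x z \<or> ?c x y = ?c x z"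
      using cV(2) unfolding gallai_def by simp
  qed
  moreover have "colors ?c U \<subseteq> K"
    using cV(3) ne f(3) unfolding colors_def by blast
  moreover have "\<not> wheel (same ?c i) U" for i
  proof
    assume "wheel (same ?c i) U"
    then obtain h p q s t where U: "{h, p, q, s, t} \<subseteq> U" "distinct [h, p, q, s, t]"
      and i: "?c h p = i" "?c h q = i" "?c h s = i" "?c h t = i"
        "?c p q = i" "?c q s = i" "?c s t = i" "?c t p = i"
      unfolding wheel_def same_def by blast
    have "{f h, f p, f q, f s, f t} \<subseteq> V" "distinct [f h, f p, f q, f s, f t]"
      using U f(3) ne by auto
    then show False
      by (rule admissible_no_wheel[OF c]) (rule i)+
  qed
  ultimately show ?thesis
    using f(1) by (simp add: admissible_def)
qed

lemma gallai_two_colors: "colors c V \<subseteq> {r, b} \<Longrightarrow> gallai c V"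
  unfolding gallai_def colors_def by blast

section \<open>The colorings on 14 and on 5 vertices\<close>

definition circulant :: "nat \<Rightarrow> nat list \<Rightarrow> nat \<Rightarrow> nat \<Rightarrow> bool" where
  "circulant n D x y \<longleftrightarrow> list_ex (\<lambda>d. (x + d) mod n = y \<or> (y + d) mod n = x) D"

definition two_coloring :: "('a \<Rightarrow> 'a \<Rightarrow> bool) \<Rightarrow> 'c \<Rightarrow> 'c \<Rightarrow> 'a \<Rightarrow> 'a \<Rightarrow> 'c" where
  "two_coloring R r b x y = (if R x y then r else b)"

lemma circulant_sym: "circulant n D x y = circulant n D y x"
  by (auto simp: circulant_def list_ex_iff)

lemma symmetric_two_coloring: "symmetric (two_coloring (circulant n D) r b)"
  unfolding symmetric_def two_coloring_def using circulant_sym by metis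

lemma colors_two_coloring: "colors (two_coloring R r b) V \<subseteq> {r, b}"
  by (auto simp: colors_def two_coloring_def)

text \<open>\<open>p\<close> and \<open>q\<close> are candidates for opposite rim vertices around
  the hub \<open>h\<close>; a wheel needs two further neighbors of \<open>h\<close> that are joined
  to both.\<close>

definition no_wheel_check :: "nat \<Rightarrow> (nat \<Rightarrow> nat \<Rightarrow> bool) \<Rightarrow> bool" where
  "no_wheel_check n R \<longleftrightarrow> list_all (\<lambda>h. list_all (\<lambda>p. list_all (\<lambda>q. p = q \<or>
     \<not> twice (map (\<lambda>x. R h x \<and> R p x \<and> R q x) [0..<n]))
     (filter (R h) [0..<n])) (filter (R h) [0..<n])) [0..<n]"

lemma twice_mapI: "x \<noteq> y \<Longrightarrow> x \<in> set vs \<Longrightarrow> y \<in> set vs \<Longrightarrow> P x \<Longrightarrow> P y \<Longrightarrow> twice (map P vs)"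
  by (induction vs) (auto simp: list_ex_iff)

lemma no_wheel_check_sound:
  assumes "no_wheel_check n R" "\<And>x y. R x y = R y x"
  shows "\<not> wheel R {..<n}"
proof
  assume "wheel R {..<n}"
  then obtain h p q s t where V: "{h, p, q, s, t} \<subseteq> {..<n}" "distinct [h, p, q, s, t]"
    and R: "R h p" "R h q" "R h s" "R h t" "R p q" "R q s" "R s t" "R t p"
    unfolding wheel_def by blast
  have "twice (map (\<lambda>x. R h x \<and> R p x \<and> R s x) [0..<n])"
    using V R assms(2)[of s q] assms(2)[of t p] by (intro twice_mapI[of q t]) auto
  then show False
    using assms(1) V R by (auto simp: no_wheel_check_def list_all_iff Ball_def)
qed

text \<open>One color has the differences 1, 3, 4 modulo 14, the other 2, 5, 6, 7.\<close>

lemma circulant_check: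
  "no_wheel_check 14 (\<lambda>x y. x \<noteq> y \<and> circulant 14 [1, 3, 4] x y)"
  "no_wheel_check 14 (\<lambda>x y. x \<noteq> y \<and> \<not> circulant 14 [1, 3, 4] x y)"
  by code_simp+

lemma admissible_circulant:
  assumes "r \<noteq> b"
  shows "admissible (two_coloring (circulant 14 [1, 3, 4]) r b) {r, b} {..<14}"
proof -
  let ?c = "two_coloring (circulant 14 [1, 3, 4]) r b"
  have same: "same ?c i = (if i = r then \<lambda>x y. x \<noteq> y \<and> circulant 14 [1, 3, 4] x y
      else if i = b then \<lambda>x y. x \<noteq> y \<and> \<not> circulant 14 [1, 3, 4] x y else (\<lambda>_ _. False))" for i
    using assms by (auto simp: same_def two_coloring_def fun_eq_iff)
  have "\<not> wheel (\<lambda>x y. x \<noteq> y \<and> circulant 14 [1, 3, 4] x y) {..<14}"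
    by (rule no_wheel_check_sound[OF circulant_check(1)]) (metis circulant_sym)
  moreover have "\<not> wheel (\<lambda>x y. x \<noteq> y \<and> \<not> circulant 14 [1, 3, 4] x y) {..<14}"
    by (rule no_wheel_check_sound[OF circulant_check(2)]) (metis circulant_sym)
  moreover have "\<not> wheel (\<lambda>_ _. False) {..<14 :: nat}"
    by (simp add: wheel_def)
  ultimately have "\<not> wheel (same ?c i) {..<14}" for i
    unfolding same by presburger
  moreover have "gallai ?c {..<14}"
    by (rule gallai_two_colors) (rule colors_two_coloring)
  ultimately show ?thesis
    by (simp add: admissible_def symmetric_two_coloring colors_two_coloring)
qed

text \<open>The 5-cycle and its complement, again a 5-cycle, contain no triangle.\<close>

lemma pentagon_check:
  "list_all (\<lambda>x. list_all (\<lambda>y. list_all (\<lambda>z. x = y \<or> y = z \<or> x = z \<or>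
     \<not> (circulant 5 [1] x y = circulant 5 [1] x z \<and> circulant 5 [1] y z = circulant 5 [1] x z))
     [0..<5]) [0..<5]) [0..<5]"
  by code_simp

lemma triangle_free_pentagon:
  assumes "r \<noteq> b"
  shows "triangle_free (two_coloring (circulant 5 [1]) r b) {..<5}"
  unfolding triangle_free_def
proof (intro ballI impI notI)
  fix x y z :: nat
  assume xyz: "x \<in> {..<5}" "y \<in> {..<5}" "z \<in> {..<5}" "x \<noteq> y" "y \<noteq> z" "x \<noteq> z"
    and "two_coloring (circulant 5 [1]) r b x y = two_coloring (circulant 5 [1]) r b x z \<and>
      two_coloring (circulant 5 [1]) r b y z = two_coloring (circulant 5 [1]) r b x z"
  moreover have "two_coloring (circulant 5 [1]) r b u v = two_coloring (circulant 5 [1]) r b u' v' \<longleftrightarrow>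
      circulant 5 [1] u v = circulant 5 [1] u' v'" for u v u' v'
    using assms by (auto simp: two_coloring_def)
  ultimately have "circulant 5 [1] x y = circulant 5 [1] x z \<and> circulant 5 [1] y z = circulant 5 [1] x z"
    by blast
  then show False
    using pentagon_check xyz unfolding list_all_iff set_upt atLeast0LessThan by blast
qed

section \<open>Iterated substitution\<close>

definition colorable :: "nat \<Rightarrow> nat \<Rightarrow> bool" where
  "colorable k N \<longleftrightarrow> (\<exists>c :: nat \<Rightarrow> nat \<Rightarrow> nat. admissible c {..<k} {..<N})"

lemma colorable_blow_up:
  fixes c' :: "nat \<Rightarrow> nat \<Rightarrow> nat"
  assumes N: "colorable k N" and g: "symmetric c'" "gallai c' {..<m}" "triangle_free c' {..<m}"
    and L: "colors c' {..<m} \<subseteq> {k..<l}" "k \<le> l"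
  shows "colorable l (m * N)"
proof -
  obtain c :: "nat \<Rightarrow> nat \<Rightarrow> nat" where c: "admissible c {..<k} {..<N}"
    using N by (auto simp: colorable_def)
  have "{..<k} \<inter> {k..<l} = {}" "{..<k} \<union> {k..<l} = {..<l}"
    using L(2) by auto
  then have adm: "admissible (blow_up c c') {..<l} ({..<m} \<times> {..<N})"
    using admissible_blow_up[OF c _ g L(1)] by simp
  \<comment> \<open>Quotient and remainder number the vertices of the blow-up: the copy and the
    place inside it.\<close>
  let ?f = "\<lambda>x. (x div N, x mod N)"
  have "inj_on ?f {..<m * N}"
    by (intro inj_onI) (metis div_mult_mod_eq prod.inject)
  moreover have "?f ` {..<m * N} \<subseteq> {..<m} \<times> {..<N}"
    by (auto simp: less_mult_imp_div_less intro!: mod_less_divisor gr0I)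
  ultimately show ?thesis
    unfolding colorable_def using admissible_pullback[OF adm finite_lessThan] by blast
qed

lemma colorable_even: "colorable (2 * m + 2) (14 * 5 ^ m)"
proof (induction m)
  case 0
  have "{0, 1} = {..<2 :: nat}"
    by auto
  then have "admissible (two_coloring (circulant 14 [1, 3, 4]) 0 1) {..<2 :: nat} {..<14}"
    using admissible_circulant[of "0 :: nat" 1] by simp
  then have "colorable 2 14"
    unfolding colorable_def by (rule exI[of _ "two_coloring (circulant 14 [1, 3, 4]) 0 1"])
  then show ?case by (simp add: numeral_2_eq_2)
next
  case (Suc m)
  let ?k = "2 * m + 2"
  have "colorable (2 * Suc m + 2) (5 * (14 * 5 ^ m))"
  proof (rule colorable_blow_up[OF Suc])
    let ?c = "two_coloring (circulant 5 [1]) ?k (?k + 1)"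
    show "symmetric ?c" "gallai ?c {..<5}"
      by (rule symmetric_two_coloring, rule gallai_two_colors[OF colors_two_coloring])
    show "triangle_free ?c {..<5}"
      by (rule triangle_free_pentagon) simp
    show "colors ?c {..<5} \<subseteq> {?k..<2 * Suc m + 2}"
      using colors_two_coloring[of "circulant 5 [1]" ?k "?k + 1" "{..<5}"] by auto
  qed simp
  then show ?case by (simp add: mult.left_commute)
qed

text \<open>Two copies of the even construction are joined by one new color; the outer graph is a
  single edge and has no triangle.\<close>

lemma colorable_odd: "colorable (2 * m + 3) (28 * 5 ^ m)"
proof -
  let ?k = "2 * m + 2"
  have "colorable (2 * m + 3) (2 * (14 * 5 ^ m))"
  proof (rule colorable_blow_up[OF colorable_even])
    let ?c = "\<lambda>(_ :: nat) (_ :: nat). ?k"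
    show "symmetric ?c" "gallai ?c {..<2}"
      by (auto simp: symmetric_def gallai_def)
    show "triangle_free ?c {..<2}"
      by (auto simp: triangle_free_def less_2_cases_iff)
    show "colors ?c {..<2} \<subseteq> {?k..<2 * m + 3}"
      by (auto simp: colors_def)
  qed simp
  then show ?thesis by simp
qed

lemma colorable_bound:
  assumes "k \<ge> 2"
  shows "colorable k (bound k)"
proof (cases "even k")
  case True
  then have "k = 2 * ((k - 2) div 2) + 2"
    using assms by presburger
  then show ?thesis
    using colorable_even bound_even by metis
next
  case False
  then have "k = 2 * ((k - 3) div 2) + 3"
    using assms by presburger
  then show ?thesis
    using colorable_odd bound_odd by metis
qed

section \<open>The Gallai-Ramsey number\<close>

lemma edges_complete_graph: "{x, y} \<in> edges (complete_graph N) \<longleftrightarrow> x < N \<and> y < N \<and> x \<noteq> y"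
  by (auto simp: complete_graph_def nsets_def card_insert_if)

lemma has_mono_copy_wheel:
  "has_mono_copy (wheel_graph 4) (complete_graph N) c \<longleftrightarrow>
     (\<exists>i. wheel (same (\<lambda>x y. c {x, y}) i) {..<N})"
proof
  assume "has_mono_copy (wheel_graph 4) (complete_graph N) c"
  then obtain f i where f: "inj_on f (verts (wheel_graph 4))"
      "f ` verts (wheel_graph 4) \<subseteq> {..<N}"
    and e: "\<And>e. e \<in> edges (wheel_graph 4) \<Longrightarrow> c (f ` e) = i"
    by (auto simp: has_mono_copy_def complete_graph_def)
  have verts: "verts (wheel_graph 4) = {4, 0, 1, 2, 3}"
    by (auto simp: wheel_graph_def cycle_graph_def)
  have rim: "{j, Suc j mod 4} \<in> edges (wheel_graph 4)" if "j < 4" for j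
    using that by (auto simp: wheel_graph_def cycle_graph_def)
  have spoke: "{4, j} \<in> edges (wheel_graph 4)" if "j < 4" for j
    using that by (auto simp: wheel_graph_def cycle_graph_def insert_commute)
  have "distinct [f 4, f 0, f 1, f 2, f 3]"
    using f(1) unfolding verts by (auto simp: inj_on_def)
  moreover have "{f 4, f 0, f 1, f 2, f 3} \<subseteq> {..<N}"
    using f(2) unfolding verts by auto
  moreover have "c {f 4, f 0} = i" "c {f 4, f 1} = i" "c {f 4, f 2} = i" "c {f 4, f 3} = i"
    "c {f 0, f 1} = i" "c {f 1, f 2} = i" "c {f 2, f 3} = i" "c {f 3, f 0} = i"
    using e[OF spoke, of 0] e[OF spoke, of 1] e[OF spoke, of 2] e[OF spoke, of 3]
      e[OF rim, of 0] e[OF rim, of 1] e[OF rim, of 2] e[OF rim, of 3]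
    by (simp_all add: numeral_2_eq_2[symmetric] numeral_3_eq_3[symmetric])
  ultimately have "wheel (same (\<lambda>x y. c {x, y}) i) {..<N}"
    unfolding wheel_def same_def
    by (intro exI[of _ "f 4"] exI[of _ "f 0"] exI[of _ "f 1"] exI[of _ "f 2"] exI[of _ "f 3"]) auto
  then show "\<exists>i. wheel (same (\<lambda>x y. c {x, y}) i) {..<N}" ..
next
  assume "\<exists>i. wheel (same (\<lambda>x y. c {x, y}) i) {..<N}"
  then obtain i where "wheel (same (\<lambda>x y. c {x, y}) i) {..<N}" ..
  then obtain h p q s t where V: "{h, p, q, s, t} \<subseteq> {..<N}" "distinct [h, p, q, s, t]"
    and i: "c {h, p} = i" "c {h, q} = i" "c {h, s} = i" "c {h, t} = i"
      "c {p, q} = i" "c {q, s} = i" "c {s, t} = i" "c {t, p} = i"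
    unfolding wheel_def same_def by blast
  \<comment> \<open>The rim vertices 0 to 3 go around the cycle, and the hub 4 goes to
    \<open>h\<close>.\<close>
  define f where "f j = [p, q, s, t, h] ! j" for j
  have f: "f 0 = p" "f 1 = q" "f (Suc 0) = q" "f 2 = s" "f 3 = t" "f 4 = h"
    by (auto simp: f_def)
  have verts: "verts (wheel_graph 4) = {4, 0, 1, 2, 3}"
    by (auto simp: wheel_graph_def cycle_graph_def)
  have "edges (wheel_graph 4) = (\<lambda>j. {j, Suc j mod 4}) ` {..<4} \<union> (\<lambda>j. {4, j}) ` {..<4}"
    by (auto simp: wheel_graph_def cycle_graph_def insert_commute)
  moreover have "{..<4} = {0, 1, 2, 3 :: nat}"
    by auto
  moreover have "Suc 0 mod 4 = 1" "Suc 1 mod 4 = 2" "Suc 2 mod 4 = 3" "Suc 3 mod 4 = 0"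
    by simp_all
  ultimately have edges: "edges (wheel_graph 4) =
      {{0, 1}, {1, 2}, {2, 3}, {3, 0}, {4, 0}, {4, 1}, {4, 2}, {4, 3}}"
    by (simp only: image_insert image_empty Un_insert_left Un_empty_left)
  have image_pair: "f ` {x, y} = {f x, f y}" for x y
    by simp
  have "\<forall>e \<in> edges (wheel_graph 4). f ` e \<in> edges (complete_graph N) \<and> c (f ` e) = i"
    unfolding edges using V i by (simp only: ball_simps image_pair f edges_complete_graph) auto
  moreover have "inj_on f (verts (wheel_graph 4))" "f ` verts (wheel_graph 4) \<subseteq> verts (complete_graph N)"
    using V unfolding verts inj_on_def by (auto simp: f complete_graph_def)
  ultimately show "has_mono_copy (wheel_graph 4) (complete_graph N) c"
    unfolding has_mono_copy_def by blast
qed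

lemma gallai_coloring_iff:
  "gallai_coloring (complete_graph N) c \<longleftrightarrow> gallai (\<lambda>x y. c {x, y}) {..<N}"
  unfolding gallai_coloring_def rainbow_triangle_def gallai_def edges_complete_graph by auto

lemma colors_complete_graph: "colors (\<lambda>x y. c {x, y}) {..<N} = c ` edges (complete_graph N)"
proof -
  have "edges (complete_graph N) = {{x, y} | x y. x < N \<and> y < N \<and> x \<noteq> y}"
    by (auto simp: complete_graph_def nsets_def card_2_iff)
  then show ?thesis
    by (auto simp: colors_def)
qed

lemma mono_wheel_exists:
  assumes "k \<ge> 1" "gallai_k_coloring k (complete_graph N) (c :: nat set \<Rightarrow> nat)" "N > bound k"
  shows "has_mono_copy (wheel_graph 4) (complete_graph N) c"
proof (rule ccontr)
  assume neg: "\<not> ?thesis"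
  let ?c = "\<lambda>x y. c {x, y}"
  let ?C = "colors ?c {..<N}"
  have C: "finite ?C" "card ?C \<le> k"
    using assms(2) finite_colors[of "{..<N}" ?c]
    by (auto simp: colors_complete_graph gallai_k_coloring_def)
  \<comment> \<open>\<open>bounded\<close> refers to palettes of exactly \<open>k\<close> colors, so
    the colors that occur are padded with others.\<close>
  have "infinite (- ?C)"
    using C(1) by (simp add: Compl_eq_Diff_UNIV Diff_infinite_finite)
  then obtain B where B: "finite B" "card B = k - card ?C" "B \<subseteq> - ?C"
    using infinite_arbitrarily_large by blast
  have "card (?C \<union> B) = k"
    using B C by (subst card_Un_disjoint) auto
  moreover have "admissible ?c (?C \<union> B) {..<N}"
    using assms(2) neg
    by (auto simp: admissible_def symmetric_def insert_commute gallai_k_coloring_def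
        gallai_coloring_iff has_mono_copy_wheel)
  ultimately have "card {..<N} \<le> bound k"
    using card_admissible[OF assms(1)] B(1) C(1) unfolding bounded_def by blast
  then show False
    using assms(3) by simp
qed

lemma wheel_free_coloring_exists:
  assumes "k \<ge> 2" "N \<le> bound k"
  obtains c :: "nat set \<Rightarrow> nat" where "gallai_k_coloring k (complete_graph N) c"
    and "\<not> has_mono_copy (wheel_graph 4) (complete_graph N) c"
proof -
  obtain c :: "nat \<Rightarrow> nat \<Rightarrow> nat" where "admissible c {..<k} {..<bound k}"
    using colorable_bound[OF assms(1)] by (auto simp: colorable_def)
  then have adm: "admissible c {..<k} {..<N}"
    using assms(2) admissible_subset by (metis lessThan_subset_iff)
  \<comment> \<open>Minimum and maximum recover the two ends of an edge; their order is irrelevant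
    because \<open>c\<close> is symmetric.\<close>
  define c' where "c' e = c (Min e) (Max e)" for e
  have "c' {x, y} = c x y" for x y
    using adm by (cases "x \<le> y") (auto simp: c'_def admissible_def symmetric_def min_def max_def)
  then have c: "(\<lambda>x y. c' {x, y}) = c"
    by (intro ext)
  have "card (c' ` edges (complete_graph N)) \<le> card {..<k}"
    using adm unfolding colors_complete_graph[of c' N, symmetric] c admissible_def
    by (intro card_mono) auto
  then have "gallai_k_coloring k (complete_graph N) c'"
    using adm by (simp add: gallai_k_coloring_def gallai_coloring_iff c admissible_def)
  moreover have "\<not> has_mono_copy (wheel_graph 4) (complete_graph N) c'"
    using adm by (simp add: has_mono_copy_wheel c admissible_def)
  ultimately show thesis
    using that by blast
qed

theorem theorem2p3:
  fixes k :: nat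
  assumes "k \<ge> 2"
  shows "gallai_ramsey k (wheel_graph 4) =
    enat (if even k then 14 * 5 ^ ((k - 2) div 2) + 1 else 28 * 5 ^ ((k - 3) div 2) + 1)"
proof -
  have "gallai_ramsey k (wheel_graph 4) = enat (bound k + 1)"
    unfolding gallai_ramsey_def
  proof (rule antisym)
    show "(INF N \<in> {N. N > 0 \<and> (\<forall>c :: nat set \<Rightarrow> nat. gallai_k_coloring k (complete_graph N) c
        \<longrightarrow> has_mono_copy (wheel_graph 4) (complete_graph N) c)}. enat N) \<le> enat (bound k + 1)"
      using mono_wheel_exists[of k "bound k + 1"] assms by (intro INF_lower) auto
    show "enat (bound k + 1) \<le> (INF N \<in> {N. N > 0 \<and> (\<forall>c :: nat set \<Rightarrow> nat.
        gallai_k_coloring k (complete_graph N) c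
        \<longrightarrow> has_mono_copy (wheel_graph 4) (complete_graph N) c)}. enat N)"
    proof (rule INF_greatest)
      fix N assume N: "N \<in> {N. N > 0 \<and> (\<forall>c :: nat set \<Rightarrow> nat. gallai_k_coloring k (complete_graph N) c
        \<longrightarrow> has_mono_copy (wheel_graph 4) (complete_graph N) c)}"
      have "\<not> N \<le> bound k"
        using N wheel_free_coloring_exists[OF assms] by blast
      then show "enat (bound k + 1) \<le> enat N"
        by simp
    qed
  qed
  then show ?thesis
    using assms by (simp add: bound_def)
qed

end
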